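(* Let $f:\mathbb{R}\to\mathbb{R}$ be a smooth positive function with $f(x)\to 0$ as $|x|\to\infty$ and with bounded first and second derivatives. Then for every sufficiently small $\epsilon>0$ there is an initial condition $h\in C^\infty(\mathbb{R})$ with $\|h\|_p<\epsilon$ for all $1\le p\le\infty$ such that, for the classical solution $u$ of the Cauchy problem $$\frac{\partial u}{\partial t}(t,x)=\frac{\partial^2 u}{\partial x^2}(t,x)-2f(x)u(t,x)-u^2(t,x)\quad (t>0,\ x\in\mathbb{R}),\qquad u(0,x)=h(x),$$ there exists a $T>0$ for which $$\lim_{t\to T^-}\|u(t)\|_\infty=\infty.$$
   Context: Here $u(t)$ denotes the function $x\mapsto u(t,x)$, $\|\cdot\|_p$ denotes the norm of $L^p(\mathbb{R})$ for $1\le p\le\infty$, and the classical solution is considered on the time interval $[0,T)$, with $u(t)\in L^\infty(\mathbb{R})$ for each $t\in[0,T)$. The function $f$ is fixed, so how small $\epsilon$ must be may depend on $f$. *)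

theory Defs
  imports "HOL-Probability.Essential_Supremum"
begin

definition smooth :: "(real \<Rightarrow> real) \<Rightarrow> bool" where
  "smooth g \<longleftrightarrow> (\<forall>n x. (deriv ^^ n) g field_differentiable (at x))"

text \<open>
  The norm of $L^p(\mathbb{R})$ for $1 \le p \le \infty$, with value \<open>\<infinity>\<close> outside of $L^p$.
  The case distinction on the integral is needed because \<open>enn2real \<infinity> = 0\<close>.
\<close>
definition Lp_norm :: "ennreal \<Rightarrow> (real \<Rightarrow> real) \<Rightarrow> ennreal" where
  "Lp_norm p g =
    (if p = \<infinity> then esssup lborel (\<lambda>x. ennreal \<bar>g x\<bar>)
     else let I = (\<integral>\<^sup>+x. ennreal (\<bar>g x\<bar> powr enn2real p) \<partial>lborel)
          in if I = \<infinity> then \<infinity> else ennreal (enn2real I powr (1 / enn2real p)))"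

definition in_Linf :: "(real \<Rightarrow> real) \<Rightarrow> bool" where
  "in_Linf g \<longleftrightarrow> g \<in> borel_measurable lborel \<and> Lp_norm \<infinity> g < \<infinity>"

text \<open>
  Classical solutions on $[0,T)$ are $C^{1,2}$ on $(0,T) \times \mathbb{R}$ and
  continuous up to $t = 0$.
\<close>
definition classical_solution ::
  "(real \<Rightarrow> real) \<Rightarrow> (real \<Rightarrow> real) \<Rightarrow> real \<Rightarrow> (real \<Rightarrow> real \<Rightarrow> real) \<Rightarrow> bool" where
  "classical_solution f h T u \<longleftrightarrow>
     continuous_on ({0..<T} \<times> UNIV) (\<lambda>(t, x). u t x) \<and>
     (\<forall>t\<in>{0<..<T}. \<forall>x.
        (\<lambda>s. u s x) field_differentiable (at t) \<and>
        u t field_differentiable (at x) \<and>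
        deriv (u t) field_differentiable (at x)) \<and>
     continuous_on ({0<..<T} \<times> UNIV) (\<lambda>(t, x). deriv (\<lambda>s. u s x) t) \<and>
     continuous_on ({0<..<T} \<times> UNIV) (\<lambda>(t, x). deriv (u t) x) \<and>
     continuous_on ({0<..<T} \<times> UNIV) (\<lambda>(t, x). deriv (deriv (u t)) x) \<and>
     (\<forall>t\<in>{0<..<T}. \<forall>x.
        deriv (\<lambda>s. u s x) t = deriv (deriv (u t)) x - 2 * f x * u t x - (u t x)\<^sup>2) \<and>
     (\<forall>x. u 0 x = h x) \<and>
     (\<forall>t\<in>{0..<T}. in_Linf (u t))"

text \<open>
  Boundedness on $[0,\tau] \times \mathbb{R}$ for every $\tau < T$. Solutions of the Cauchy problem
  are unique within this class; if the bound on \<open>u t\<close> is allowed to degenerate at some time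
  before $T$, uniqueness already fails for the heat equation.
\<close>
definition locally_bounded_in_time :: "real \<Rightarrow> (real \<Rightarrow> real \<Rightarrow> real) \<Rightarrow> bool" where
  "locally_bounded_in_time T u \<longleftrightarrow> (\<forall>\<tau>\<in>{0..<T}. (SUP t\<in>{0..\<tau>}. Lp_norm \<infinity> (u t)) < \<infinity>)"

end

theory Submission
  imports Defs "HOL-Probability.Probability" "HOL-Real_Asymp.Real_Asymp"
begin

text \<open>
  The sign of the square makes negative values dangerous: \<open>w = - u\<close> solves
  \<open>w_t = w_xx - 2 f w + w^2\<close>, and without the potential every nontrivial nonnegative datum on the
  line blows up. The potential \<open>f\<close> is positive, but it decays, so it can be made negligible by
  placing the datum far out. Concretely, \<open>h\<close> is a small negative Gaussian of fixed width and
  height \<open>A = \<epsilon> / 3\<close>, centred at a far point \<open>m\<close>. On an interval of half-width \<open>R\<close> around \<open>m\<close>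
  the average \<open>G\<close> of \<open>w\<close> against a normalised bump satisfies \<open>G' \<ge> G^2 - \<kappa> G\<close> with
  \<open>\<kappa> = 6 / R^2 + 2 sup f\<close>, the supremum being over the interval (Kaplan's argument). Initially
  \<open>G\<close> is of order \<open>A / R\<close>, which beats \<open>6 / R^2\<close> once \<open>R\<close> is a large multiple of \<open>1 / A\<close>; then \<open>m\<close> is
  chosen so far out that \<open>f\<close> stays below a small fraction of \<open>A / R\<close> on the interval. Hence \<open>G\<close>,
  and with it the solution, cannot live longer than \<open>1 / (G 0 - \<kappa>)\<close> (\<open>riccati_blow_up\<close>, \<open>blow_up_time_bound\<close>).

  The remaining work is to have a solution at all, up to a maximal time at which the supremum
  norm really tends to infinity. Local solutions are fixed points of Duhamel's formula for the
  heat semigroup, applied simultaneously to \<open>u\<close>, \<open>u_x\<close> and \<open>u_xx\<close>. Since \<open>f\<close> has bounded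
  derivatives up to second order, the reaction term acts on this triple as a locally Lipschitz map, and a
  Duhamel integral whose source has two bounded spatial derivatives is differentiable in time
  (\<open>duhamel_has_time_derivative\<close>); hence the fixed point is a classical solution.
  Weighting the triple as \<open>(u, \<delta> u_x, \<delta>^2 u_xx)\<close> with a small \<open>\<delta>\<close> makes the norm of
  the data as close to \<open>sup |h|\<close> as desired without spoiling the Lipschitz constant; hence the existence time in
  \<open>local_existence\<close> depends on \<open>sup |h|\<close> alone. Therefore, if \<open>\<parallel>u(t)\<parallel>\<close> failed to tend to infinity at the maximal
  time, restarting from a late time with moderate norm would continue the solution beyond it
  (\<open>maximal_solution\<close>). Uniqueness, which the gluing of solutions rests on, and the sign of \<open>u\<close>
  come from the maximum principle for bounded functions on the line.
\<close>

section \<open>Parameter integrals and Gaussian averages\<close>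

lemma continuous_on_param_integral:
  fixes g :: "'x::metric_space \<Rightarrow> 'w \<Rightarrow> 'e::{banach, second_countable_topology}"
  assumes fin: "finite_measure M"
    and cont: "\<And>w. continuous_on UNIV (\<lambda>x. g x w)"
    and meas: "\<And>x. g x \<in> borel_measurable M"
    and bnd: "\<And>x w. norm (g x w) \<le> B"
  shows "continuous_on UNIV (\<lambda>x. \<integral>w. g x w \<partial>M)"
proof (rule continuous_at_imp_continuous_on, rule ballI)
  fix a :: 'x
  interpret finite_measure M by fact
  show "isCont (\<lambda>x. \<integral>w. g x w \<partial>M) a"
    unfolding continuous_at_sequentially comp_def
  proof (intro allI impI)
    fix X :: "nat \<Rightarrow> 'x" assume X: "X \<longlonglongrightarrow> a"
    show "(\<lambda>n. \<integral>w. g (X n) w \<partial>M) \<longlonglongrightarrow> (\<integral>w. g a w \<partial>M)"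
    proof (rule integral_dominated_convergence[where w="\<lambda>_. B"])
      show "AE w in M. (\<lambda>n. g (X n) w) \<longlonglongrightarrow> g a w"
        using cont X by (intro AE_I2 continuous_on_tendsto_compose[OF cont X]) auto
    qed (use meas bnd in auto)
  qed
qed

lemma has_real_derivative_param_integral:
  fixes g g' :: "real \<Rightarrow> 'w \<Rightarrow> real"
  assumes int: "\<And>y. y \<in> S \<Longrightarrow> integrable M (g y)"
    and meas: "g' x \<in> borel_measurable M"
    and S: "open S" "convex S" "x \<in> S"
    and der: "\<And>w y. y \<in> S \<Longrightarrow> ((\<lambda>y. g y w) has_real_derivative g' y w) (at y)"
    and bnd: "\<And>w y. y \<in> S \<Longrightarrow> \<bar>g' y w\<bar> \<le> B w"
    and B: "integrable M B"
  shows "((\<lambda>y. \<integral>w. g y w \<partial>M) has_real_derivative (\<integral>w. g' x w \<partial>M)) (at x)"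
  unfolding has_field_derivative_iff tendsto_at_iff_sequentially comp_def
proof (intro allI impI)
  fix X :: "nat \<Rightarrow> real" assume X: "\<forall>i. X i \<in> UNIV - {x}" "X \<longlonglongrightarrow> x"
  then have nz: "\<And>i. X i - x \<noteq> 0" by auto
  have "eventually (\<lambda>n. X n \<in> S) sequentially"
    using S X(2) by (intro topological_tendstoD) auto
  then obtain k where k: "\<And>n. n \<ge> k \<Longrightarrow> X n \<in> S" by (auto simp: eventually_sequentially)
  let ?q = "\<lambda>n w. (g (X n) w - g x w) / (X n - x)"
  have lip: "\<bar>g y w - g x w\<bar> \<le> B w * \<bar>y - x\<bar>" if "y \<in> S" for y w
    using field_differentiable_bound[OF S(2), of "\<lambda>y. g y w" "\<lambda>y. g' y w" "B w" y x] der bnd that S(3)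
    by (auto intro: has_field_derivative_at_within)
  have "(\<lambda>n. \<integral>w. ?q (n + k) w \<partial>M) \<longlonglongrightarrow> (\<integral>w. g' x w \<partial>M)"
  proof (rule integral_dominated_convergence[where w=B])
    show "(\<lambda>w. ?q (n + k) w) \<in> borel_measurable M" for n
      using int[OF k, of "n+k"] int[OF S(3)] by (auto dest!: borel_measurable_integrable)
    show "AE w in M. (\<lambda>n. ?q (n + k) w) \<longlonglongrightarrow> g' x w"
    proof (rule AE_I2)
      fix w
      have "((\<lambda>y. (g y w - g x w) / (y - x)) \<longlongrightarrow> g' x w) (at x)"
        using der[OF S(3), of w] by (simp add: has_field_derivative_iff)
      then have "(\<lambda>n. ?q n w) \<longlonglongrightarrow> g' x w"
        using X unfolding tendsto_at_iff_sequentially comp_def by blast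
      then show "(\<lambda>n. ?q (n + k) w) \<longlonglongrightarrow> g' x w" by (rule LIMSEQ_ignore_initial_segment)
    qed
    show "AE w in M. norm (?q (n + k) w) \<le> B w" for n
      using lip[OF k, of "n+k"] nz[of "n+k"] by (intro AE_I2) (auto simp: divide_le_eq)
  qed (use meas B in auto)
  also have "(\<lambda>n. \<integral>w. ?q (n + k) w \<partial>M) =
      (\<lambda>n. ((\<integral>w. g (X (n+k)) w \<partial>M) - (\<integral>w. g x w \<partial>M)) / (X (n+k) - x))"
    using int[OF k] int[OF S(3)] by auto
  finally show "(\<lambda>n. ((\<integral>w. g (X n) w \<partial>M) - (\<integral>w. g x w \<partial>M)) / (X n - x)) \<longlonglongrightarrow> (\<integral>w. g' x w \<partial>M)"
    by (rule LIMSEQ_offset)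
qed

definition gauss :: "real measure" where
  "gauss = density lborel std_normal_density"

lemma prob_space_gauss: "prob_space gauss"
  unfolding gauss_def by (rule prob_space_normal_density) simp

lemma sets_gauss [simp, measurable_cong]: "sets gauss = sets borel"
  by (simp add: gauss_def)

lemma space_gauss [simp]: "space gauss = UNIV"
  by (simp add: gauss_def)

lemma integral_gauss:
  fixes g :: "real \<Rightarrow> real"
  assumes "g \<in> borel_measurable borel"
  shows "(\<integral>z. g z \<partial>gauss) = (\<integral>z. std_normal_density z * g z \<partial>lborel)"
  unfolding gauss_def using assms by (subst integral_density) auto

lemma integrable_gauss_iff:
  fixes g :: "real \<Rightarrow> real"
  assumes "g \<in> borel_measurable borel"
  shows "integrable gauss g \<longleftrightarrow> integrable lborel (\<lambda>z. std_normal_density z * g z)"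
  unfolding gauss_def using assms by (subst integrable_density) auto

lemma integrable_gauss_bounded:
  fixes g :: "real \<Rightarrow> real"
  assumes "g \<in> borel_measurable borel" "\<And>z. \<bar>g z\<bar> \<le> B"
  shows "integrable gauss g"
proof -
  interpret prob_space gauss by (rule prob_space_gauss)
  show ?thesis using assms by (intro integrable_const_bound[where B=B]) auto
qed

lemma integrable_gauss_abs: "integrable gauss (\<lambda>z. \<bar>z\<bar>)"
  using integrable_std_normal_moment_abs[of 1] by (subst integrable_gauss_iff) auto

lemma integrable_gauss_mult_bounded:
  fixes g :: "real \<Rightarrow> real"
  assumes "g \<in> borel_measurable borel" "\<And>z. \<bar>g z\<bar> \<le> B"
  shows "integrable gauss (\<lambda>z. z * g z)"
proof (rule Bochner_Integration.integrable_bound)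
  show "integrable gauss (\<lambda>z. B * \<bar>z\<bar>)" using integrable_gauss_abs by simp
  show "AE z in gauss. norm (z * g z) \<le> norm (B * \<bar>z\<bar>)"
  proof (rule AE_I2)
    fix z
    have "\<bar>z\<bar> * \<bar>g z\<bar> \<le> \<bar>z\<bar> * \<bar>B\<bar>" using assms(2)[of z] by (intro mult_left_mono) auto
    then show "norm (z * g z) \<le> norm (B * \<bar>z\<bar>)" by (simp add: abs_mult mult.commute)
  qed
qed (use assms in measurable)

lemma std_normal_density_tendsto_0:
  "(std_normal_density \<longlongrightarrow> 0) at_top" "(std_normal_density \<longlongrightarrow> 0) at_bot"
proof -
  have *: "((\<lambda>x::real. exp (- x\<^sup>2 / 2) / sqrt (2 * pi)) \<longlongrightarrow> 0) at_top"
    by real_asymp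
  have **: "((\<lambda>x::real. exp (- x\<^sup>2 / 2) / sqrt (2 * pi)) \<longlongrightarrow> 0) at_bot"
    by real_asymp
  show "(std_normal_density \<longlongrightarrow> 0) at_top" "(std_normal_density \<longlongrightarrow> 0) at_bot"
    using * ** by (auto simp: std_normal_density_def[abs_def] field_simps)
qed

text \<open>
  Stein's identity is integration by parts for the Gaussian weight, whose derivative at \<open>z\<close> is \<open>- z\<close>
  times itself. It turns the derivative of a Gaussian average with respect to the variance
  into an average of the second derivative.
\<close>

lemma stein:
  fixes k k' :: "real \<Rightarrow> real"
  assumes der: "\<And>z. (k has_real_derivative k' z) (at z)"
    and cont: "continuous_on UNIV k'"
    and bk: "\<And>z. \<bar>k z\<bar> \<le> B" and bk': "\<And>z. \<bar>k' z\<bar> \<le> B"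
  shows "(\<integral>z. z * k z \<partial>gauss) = (\<integral>z. k' z \<partial>gauss)"
proof -
  have contk: "continuous_on UNIV k"
    using der by (auto intro!: DERIV_continuous_on intro: has_field_derivative_at_within)
  have mk[measurable]: "k \<in> borel_measurable borel" and mk'[measurable]: "k' \<in> borel_measurable borel"
    using cont contk by (auto intro: borel_measurable_continuous_onI)
  let ?F = "\<lambda>z. std_normal_density z * k z"
  let ?f = "\<lambda>z. std_normal_density z * k' z - std_normal_density z * (z * k z)"
  have i1: "integrable lborel (\<lambda>z. std_normal_density z * k' z)"
    using integrable_gauss_bounded[OF mk' bk'] by (simp add: integrable_gauss_iff)
  have i2: "integrable lborel (\<lambda>z. std_normal_density z * (z * k z))"
    using integrable_gauss_mult_bounded[OF mk bk] by (simp add: integrable_gauss_iff)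
  have dF: "(?F has_real_derivative ?f z) (at z)" for z
  proof -
    have "(std_normal_density has_real_derivative std_normal_density z * (- z)) (at z)"
      unfolding std_normal_density_def[abs_def]
      by (rule derivative_eq_intros refl | simp add: power2_eq_square)+
    then show ?thesis by (auto intro!: derivative_eq_intros der simp: algebra_simps)
  qed
  have lim0: "((\<lambda>z. std_normal_density z * k z) \<longlongrightarrow> 0) F" if "(std_normal_density \<longlongrightarrow> 0) F" for F
  proof (rule Lim_null_comparison)
    show "\<forall>\<^sub>F z in F. norm (std_normal_density z * k z) \<le> std_normal_density z * B"
      using bk by (intro always_eventually) (auto simp: abs_mult intro!: mult_left_mono)
    show "((\<lambda>z. std_normal_density z * B) \<longlongrightarrow> 0) F"
      using tendsto_mult_right[OF that, of B] by (simp add: mult.commute)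
  qed
  have "(LBINT x=-\<infinity>..\<infinity>. ?f x) = 0 - 0"
  proof (rule interval_integral_FTC_integrable[where F="?F"])
    show "(?F has_vector_derivative ?f x) (at x)" for x
      using dF has_real_derivative_iff_has_vector_derivative by blast
    show "isCont ?f x" for x
      using cont contk unfolding std_normal_density_def
      by (intro continuous_intros) (auto simp: continuous_on_eq_continuous_at)
    show "set_integrable lborel (einterval (- \<infinity>) \<infinity>) ?f"
      using i1 i2 by (simp add: set_integrable_def)
    show "((?F \<circ> real_of_ereal) \<longlongrightarrow> 0) (at_right (-\<infinity>))"
      using lim0[OF std_normal_density_tendsto_0(2)]
      by (simp add: ereal_tendsto_simps)
    show "((?F \<circ> real_of_ereal) \<longlongrightarrow> 0) (at_left \<infinity>)"
      using lim0[OF std_normal_density_tendsto_0(1)]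
      by (simp add: ereal_tendsto_simps)
  qed simp
  then have "(\<integral>z. ?f z \<partial>lborel) = 0"
    by (simp add: interval_integral_to_infinity_eq interval_lebesgue_integral_def set_lebesgue_integral_def)
  then show ?thesis using i1 i2 by (simp add: integral_gauss)
qed

section \<open>The heat semigroup and Duhamel's formula\<close>

lemma continuous_on_compose_pair:
  assumes "continuous_on UNIV (\<lambda>(p, y). g p y)" "continuous_on S a" "continuous_on S b"
  shows "continuous_on S (\<lambda>z. g (a z) (b z))"
  using continuous_on_compose2[OF assms(1) continuous_on_Pair[OF assms(2,3)]] by simp

text \<open>
  The heat semigroup at time \<open>r\<close>, as the expectation of \<open>g\<close> at a Brownian particle that starts in \<open>x\<close>.
  In contrast to the convolution with the heat kernel, this form makes sense at \<open>r = 0\<close>, and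
  it depends continuously on all of its data, for negative \<open>r\<close> as well because \<open>sqrt\<close> is odd.
\<close>

definition heat :: "real \<Rightarrow> (real \<Rightarrow> real) \<Rightarrow> real \<Rightarrow> real" where
  "heat r g x = (\<integral>z. g (x + sqrt (2 * r) * z) \<partial>gauss)"

lemma heat_0 [simp]: "heat 0 g x = g x"
  using prob_space.prob_space[OF prob_space_gauss] by (simp add: heat_def)

lemma continuous_on_heat:
  fixes g :: "'a::metric_space \<Rightarrow> real \<Rightarrow> real"
  assumes cont: "continuous_on UNIV (\<lambda>(p, y). g p y)" and bnd: "\<And>p y. \<bar>g p y\<bar> \<le> B"
    and r: "continuous_on UNIV r" and q: "continuous_on UNIV q" and x: "continuous_on UNIV x"
  shows "continuous_on UNIV (\<lambda>p::'b::metric_space. heat (r p) (g (q p)) (x p))"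
  unfolding heat_def
proof (rule continuous_on_param_integral[where B=B])
  show "finite_measure gauss" using prob_space_gauss by (rule prob_space.finite_measure)
  show "continuous_on UNIV (\<lambda>p. g (q p) (x p + sqrt (2 * r p) * z))" for z
    by (intro continuous_on_compose_pair[OF cont] continuous_intros r q x)
  show "(\<lambda>z. g (q p) (x p + sqrt (2 * r p) * z)) \<in> borel_measurable gauss" for p
  proof -
    have "continuous_on UNIV (\<lambda>z. g (q p) (x p + sqrt (2 * r p) * z))"
      by (intro continuous_on_compose_pair[OF cont] continuous_intros)
    then show ?thesis by (simp add: borel_measurable_continuous_onI cong: measurable_cong_sets)
  qed
qed (use bnd in auto)

lemma abs_heat_le:
  assumes "\<And>y. \<bar>g y\<bar> \<le> B"
  shows "\<bar>heat r g x\<bar> \<le> B"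
proof -
  interpret prob_space gauss by (rule prob_space_gauss)
  have B: "0 \<le> B" using assms[of 0] by linarith
  show ?thesis
  proof (cases "integrable gauss (\<lambda>z. g (x + sqrt (2 * r) * z))")
    case True
    have "norm (\<integral>z. g (x + sqrt (2 * r) * z) \<partial>gauss) \<le> (\<integral>z. norm (g (x + sqrt (2 * r) * z)) \<partial>gauss)"
      by (rule integral_norm_bound)
    also have "\<dots> \<le> (\<integral>z. B \<partial>gauss)"
      by (rule integral_mono) (use True assms in auto)
    finally show ?thesis using prob_space by (simp add: heat_def)
  qed (simp add: heat_def not_integrable_integral_eq B)
qed

lemma set_integral_eq_of_derivative:
  fixes F F' :: "real \<Rightarrow> real"
  assumes "a \<le> b" "continuous_on {a..b} F" "continuous_on {a..b} F'"
    and "\<And>x. a < x \<Longrightarrow> x < b \<Longrightarrow> (F has_real_derivative F' x) (at x)"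
  shows "(LINT x:{a..b}|lborel. F' x) = F b - F a"
proof -
  have "(F' has_integral F b - F a) {a..b}"
    using assms by (intro fundamental_theorem_of_calculus_interior)
      (auto simp: has_real_derivative_iff_has_vector_derivative)
  moreover have "(LINT x:{a..b}|lborel. F' x) = integral {a..b} F'"
    using assms by (intro set_borel_integral_eq_integral borel_integrable_atLeastAtMost')
  ultimately show ?thesis by (simp add: integral_unique)
qed

lemma set_integral_point: "(LINT s:{a..a}|lborel. k s) = (0::real)" for a :: real
proof -
  have "(LINT s:{a..a}|lborel. k s) = (LINT s:{a..a}|lborel. k a)"
    by (rule set_lebesgue_integral_cong) auto
  then show ?thesis by (simp add: set_lebesgue_integral_def)
qed

text \<open>
  The heat equation in integrated form. For \<open>s > 0\<close> the chain rule produces a factor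
  \<open>z / sqrt (2 * s)\<close> under the integral, and Stein's identity trades it for a second
  derivative of \<open>g\<close>; the result is continuous down to \<open>s = 0\<close>, where the average itself need not be
  differentiable in the two-sided sense.
\<close>

lemma heat_increment:
  fixes g g' g'' :: "real \<Rightarrow> real"
  assumes g: "\<And>y. (g has_real_derivative g' y) (at y)"
    and g': "\<And>y. (g' has_real_derivative g'' y) (at y)"
    and cont: "continuous_on UNIV g''"
    and bnd: "\<And>y. \<bar>g y\<bar> \<le> B" "\<And>y. \<bar>g' y\<bar> \<le> B" "\<And>y. \<bar>g'' y\<bar> \<le> B"
    and r: "0 \<le> r"
  shows "heat r g x - g x = (LINT s:{0..r}|lborel. heat s g'' x)"
proof -
  have B: "0 \<le> B" using bnd(1)[of 0] by linarith
  have contg: "continuous_on UNIV g" and contg': "continuous_on UNIV g'"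
    using g g' by (auto intro!: DERIV_continuous_on intro: has_field_derivative_at_within)
  have m: "(\<lambda>z. k (x + c * z)) \<in> borel_measurable borel" if "continuous_on UNIV k" for k :: "real \<Rightarrow> real" and c
    by (intro borel_measurable_continuous_onI continuous_on_compose2[OF that]) (auto intro!: continuous_intros)
  have ch: "continuous_on UNIV (\<lambda>s. heat s k x)" if "continuous_on UNIV k" "\<And>y. \<bar>k y\<bar> \<le> B" for k
  proof (rule continuous_on_heat[where g="\<lambda>_::real. k" and q="\<lambda>_. 0" and B=B])
    show "continuous_on UNIV (\<lambda>(p::real, y). k y)"
      unfolding case_prod_beta by (rule continuous_on_compose2[OF that(1)]) (auto intro!: continuous_intros)
  qed (use that in \<open>auto intro!: continuous_intros\<close>)
  have der: "((\<lambda>s. heat s g x) has_real_derivative heat s g'' x) (at s)" if s: "0 < s" for s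
  proof -
    let ?d = "\<lambda>y z. g' (x + sqrt (2 * y) * z) * (z / sqrt (2 * y))"
    have "((\<lambda>y. \<integral>z. g (x + sqrt (2 * y) * z) \<partial>gauss) has_real_derivative (\<integral>z. ?d s z \<partial>gauss)) (at s)"
    proof (rule has_real_derivative_param_integral[where S="{s/2<..}" and B="\<lambda>z. B / sqrt s * \<bar>z\<bar>"])
      show "integrable gauss (\<lambda>z. g (x + sqrt (2 * y) * z))" for y
        using m[OF contg] bnd by (intro integrable_gauss_bounded)
      show "?d s \<in> borel_measurable gauss"
        using m[OF contg'] by measurable
      show "((\<lambda>y. g (x + sqrt (2 * y) * z)) has_real_derivative ?d y z) (at y)"
        if "y \<in> {s/2<..}" for y z
      proof (rule DERIV_chain2[OF g])
        show "((\<lambda>y. x + sqrt (2 * y) * z) has_real_derivative z / sqrt (2 * y)) (at y)"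
          using that s by (auto intro!: derivative_eq_intros simp: field_simps)
      qed
      show "\<bar>?d y z\<bar> \<le> B / sqrt s * \<bar>z\<bar>" if "y \<in> {s/2<..}" for y z
      proof -
        have "\<bar>?d y z\<bar> = \<bar>g' (x + sqrt (2 * y) * z)\<bar> * (\<bar>z\<bar> / sqrt (2 * y))"
          using that s by (simp add: abs_mult)
        also have "\<dots> \<le> B * (\<bar>z\<bar> / sqrt s)"
          using that s bnd(2) B by (intro mult_mono divide_left_mono) auto
        finally show ?thesis by simp
      qed
      show "integrable gauss (\<lambda>z. B / sqrt s * \<bar>z\<bar>)" using integrable_gauss_abs by simp
    qed (use s in auto)
    also have "(\<integral>z. ?d s z \<partial>gauss) = (\<integral>z. z * g' (x + sqrt (2 * s) * z) \<partial>gauss) / sqrt (2 * s)"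
      by (simp add: mult.commute)
    also have "(\<integral>z. z * g' (x + sqrt (2 * s) * z) \<partial>gauss) = (\<integral>z. g'' (x + sqrt (2 * s) * z) * sqrt (2 * s) \<partial>gauss)"
    proof (rule stein[where B="B + B * sqrt (2 * s)"])
      show "((\<lambda>z. g' (x + sqrt (2 * s) * z)) has_real_derivative g'' (x + sqrt (2 * s) * z) * sqrt (2 * s)) (at z)" for z
        by (auto intro!: derivative_eq_intros DERIV_chain2[OF g'])
      show "continuous_on UNIV (\<lambda>z. g'' (x + sqrt (2 * s) * z) * sqrt (2 * s))"
        by (intro continuous_intros continuous_on_compose2[OF cont]) auto
      show "\<bar>g' (x + sqrt (2 * s) * z)\<bar> \<le> B + B * sqrt (2 * s)" for z
        using bnd(2) B s by (intro order_trans[OF bnd(2)]) auto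
      show "\<bar>g'' (x + sqrt (2 * s) * z) * sqrt (2 * s)\<bar> \<le> B + B * sqrt (2 * s)" for z
        using bnd(3)[of "x + sqrt (2 * s) * z"] B s by (simp add: abs_mult add_increasing mult_right_mono)
    qed
    also have "\<dots> / sqrt (2 * s) = heat s g'' x" using s by (simp add: heat_def)
    finally show ?thesis by (simp add: heat_def[abs_def])
  qed
  have "(LINT s:{0..r}|lborel. heat s g'' x) = heat r g x - heat 0 g x"
    using r der ch[OF contg bnd(1)] ch[OF cont bnd(3)]
    by (intro set_integral_eq_of_derivative) (auto intro: continuous_on_subset)
  then show ?thesis by simp
qed

text \<open>
  Both sides integrate \<open>K s (r - s)\<close> over the triangle \<open>0 \<le> s \<le> r \<le> t\<close>.
\<close>

lemma triangle_integral_swap: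
  fixes K :: "real \<Rightarrow> real \<Rightarrow> real"
  assumes cont: "continuous_on UNIV (\<lambda>(s, r). K s r)" and bnd: "\<And>s r. \<bar>K s r\<bar> \<le> B"
    and t: "0 \<le> t"
  shows "(LINT s:{0..t}|lborel. LINT r:{0..t - s}|lborel. K s r)
       = (LINT r:{0..t}|lborel. LINT s:{0..r}|lborel. K s (r - s))"
proof -
  have B: "0 \<le> B" using bnd[of 0 0] by linarith
  \<comment> \<open>After shifting \<open>r\<close> by \<open>s\<close>, the triangle is cut out of a square by indicator functions.\<close>
  define \<phi> where "\<phi> s r = indicator {0..t} s * (indicator {s..t} r * K s (r - s))" for s r :: real
  have eq\<phi>: "\<phi> s r = (if 0 \<le> s \<and> s \<le> r \<and> r \<le> t then K s (r - s) else 0)" for s r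
    by (auto simp: \<phi>_def indicator_def)
  have [measurable]: "(\<lambda>(s, r). K s (r - s)) \<in> borel_measurable borel"
    unfolding case_prod_beta
    by (intro borel_measurable_continuous_onI continuous_on_compose_pair[OF cont] continuous_intros)
  have [measurable]: "(\<lambda>(s, r). K s (r - s)) \<in> borel_measurable (borel \<Otimes>\<^sub>M borel)"
    by (simp add: borel_prod)
  have K': "(\<lambda>p. K (fst p) (snd p - fst p)) \<in> borel_measurable (borel \<Otimes>\<^sub>M borel)"
    using \<open>(\<lambda>(s, r). K s (r - s)) \<in> borel_measurable (borel \<Otimes>\<^sub>M borel)\<close> by (simp add: case_prod_beta)
  have meas: "(\<lambda>p. \<phi> (fst p) (snd p)) \<in> borel_measurable (lborel \<Otimes>\<^sub>M lborel)"
    unfolding eq\<phi> using K' by measurable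
  have int: "integrable (lborel \<Otimes>\<^sub>M lborel) (\<lambda>(s, r). \<phi> s r)"
  proof (rule Bochner_Integration.integrable_bound)
    show "integrable (lborel \<Otimes>\<^sub>M lborel) (\<lambda>p. B * indicator ({0..t} \<times> {0..t}) p :: real)"
      by (intro integrable_mult_right integrable_real_indicator)
        (use t in \<open>auto simp: lborel.emeasure_pair_measure_Times ennreal_mult_less_top\<close>)
    show "AE p in lborel \<Otimes>\<^sub>M lborel. norm (case p of (s, r) \<Rightarrow> \<phi> s r)
        \<le> norm (B * indicator ({0..t} \<times> {0..t}) p :: real)"
      using bnd B by (intro AE_I2) (auto simp: eq\<phi> indicator_def split: if_splits)
  qed (use meas in \<open>simp add: case_prod_beta\<close>)
  have inner1: "(LINT r:{0..t - s}|lborel. K s r) = (\<integral>r. indicator {s..t} r * K s (r - s) \<partial>lborel)" for s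
  proof -
    have "(LINT r:{0..t - s}|lborel. K s r) = (\<integral>r. indicator {0..t - s} (-s + 1 * r) * K s (-s + 1 * r) \<partial>lborel)"
      unfolding set_lebesgue_integral_def
      by (subst lborel_integral_real_affine[where c=1 and t="-s"]) auto
    also have "\<dots> = (\<integral>r. indicator {s..t} r * K s (r - s) \<partial>lborel)"
      by (intro Bochner_Integration.integral_cong) (auto simp: indicator_def)
    finally show ?thesis .
  qed
  have "(LINT s:{0..t}|lborel. LINT r:{0..t - s}|lborel. K s r) = (\<integral>s. (\<integral>r. \<phi> s r \<partial>lborel) \<partial>lborel)"
    unfolding inner1 by (simp add: set_lebesgue_integral_def \<phi>_def)
  also have "\<dots> = (\<integral>r. (\<integral>s. \<phi> s r \<partial>lborel) \<partial>lborel)"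
    by (rule lborel_pair.Fubini_integral[OF int, symmetric])
  also have "\<dots> = (LINT r:{0..t}|lborel. LINT s:{0..r}|lborel. K s (r - s))"
    unfolding set_lebesgue_integral_def real_scaleR_def
      Bochner_Integration.integral_mult_right_zero[symmetric]
    by (intro Bochner_Integration.integral_cong refl) (auto simp: eq\<phi> indicator_def)
  finally show ?thesis .
qed

definition duhamel :: "real \<Rightarrow> (real \<Rightarrow> real) \<Rightarrow> (real \<Rightarrow> real \<Rightarrow> real) \<Rightarrow> real \<Rightarrow> real" where
  "duhamel t h G x = heat t h x + (LINT s:{0..t}|lborel. heat (t - s) (G s) x)"

text \<open>
  Differentiating \<open>heat (t - s)\<close> in \<open>t\<close> under the integral meets the singular factor of the chain rule at \<open>s = t\<close>.
  Instead, each average is replaced by its value at time zero plus an integral over the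
  elapsed time (\<open>heat_increment\<close>). Exchanging the order of integration over the triangle
  collects the averages of the second derivatives into the Duhamel integral of \<open>G''\<close>.
\<close>

lemma duhamel_increment:
  assumes h: "\<And>y. (h has_real_derivative h' y) (at y)" "\<And>y. (h' has_real_derivative h'' y) (at y)"
    "continuous_on UNIV h''"
    and hb: "\<And>y. \<bar>h y\<bar> \<le> B" "\<And>y. \<bar>h' y\<bar> \<le> B" "\<And>y. \<bar>h'' y\<bar> \<le> B"
    and G: "\<And>s y. (G s has_real_derivative G' s y) (at y)" "\<And>s y. (G' s has_real_derivative G'' s y) (at y)"
    and Gc: "continuous_on UNIV (\<lambda>(s, y). G s y)" "continuous_on UNIV (\<lambda>(s, y). G'' s y)"
    and Gb: "\<And>s y. \<bar>G s y\<bar> \<le> B" "\<And>s y. \<bar>G' s y\<bar> \<le> B" "\<And>s y. \<bar>G'' s y\<bar> \<le> B"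
    and cont: "continuous_on {0..t} (\<lambda>r. duhamel r h'' G'' x)"
    and t: "0 \<le> t"
  shows "duhamel t h G x = h x + (LINT r:{0..t}|lborel. duhamel r h'' G'' x + G r x)"
proof -
  have cG'': "continuous_on UNIV (G'' s)" for s
    by (intro continuous_on_compose_pair[OF Gc(2)] continuous_intros)
  have cG: "continuous_on UNIV (\<lambda>s. G s x)"
    by (intro continuous_on_compose_pair[OF Gc(1)] continuous_intros)
  have ch: "continuous_on UNIV (\<lambda>r. heat r h'' x)"
    by (rule continuous_on_heat[where g="\<lambda>_::real. h''" and q="\<lambda>_. 0" and B=B])
      (auto intro!: continuous_intros hb continuous_on_compose2[OF h(3)] simp: case_prod_beta)
  have cK: "continuous_on UNIV (\<lambda>(s, r). heat r (G'' s) x)"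
    unfolding case_prod_beta
    by (rule continuous_on_heat[where g=G'' and B=B]) (auto intro!: continuous_intros Gb Gc)
  let ?I = "\<lambda>r. LINT s:{0..r}|lborel. heat (r - s) (G'' s) x"
  have cI: "continuous_on {0..t} ?I"
  proof -
    have "continuous_on {0..t} (\<lambda>r. duhamel r h'' G'' x - heat r h'' x)"
      by (intro continuous_on_diff cont continuous_on_subset[OF ch]) auto
    then show ?thesis by (simp add: duhamel_def)
  qed
  have si: "set_integrable lborel {0..t} k" if "continuous_on {0..t} k" for k :: "real \<Rightarrow> real"
    using that by (rule borel_integrable_atLeastAtMost')
  have "(LINT s:{0..t}|lborel. heat (t - s) (G s) x)
      = (LINT s:{0..t}|lborel. G s x + (LINT r:{0..t - s}|lborel. heat r (G'' s) x))"
  proof (rule set_lebesgue_integral_cong)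
    show "\<forall>s. s \<in> {0..t} \<longrightarrow> heat (t - s) (G s) x = G s x + (LINT r:{0..t - s}|lborel. heat r (G'' s) x)"
      using heat_increment[OF G(1) G(2) cG'' Gb(1) Gb(2) Gb(3), of "t - _" _ x] by (auto simp: algebra_simps)
  qed simp
  also have "\<dots> = (LINT s:{0..t}|lborel. G s x) + (LINT s:{0..t}|lborel. LINT r:{0..t - s}|lborel. heat r (G'' s) x)"
  proof (rule set_integral_add(2))
    show "set_integrable lborel {0..t} (\<lambda>s. G s x)" by (intro si continuous_on_subset[OF cG]) auto
    have "continuous_on {0..t} (\<lambda>s. heat (t - s) (G s) x - G s x)"
      by (intro continuous_on_diff continuous_on_subset[OF cG]
          continuous_on_subset[OF continuous_on_heat[where g=G and B=B and q="\<lambda>s. s" and r="\<lambda>s. t - s" and x="\<lambda>_. x"], of "{0..t}"])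
        (auto intro!: continuous_intros Gb Gc)
    then have "set_integrable lborel {0..t} (\<lambda>s. heat (t - s) (G s) x - G s x)" by (rule si)
    also have "?this \<longleftrightarrow> set_integrable lborel {0..t} (\<lambda>s. LINT r:{0..t - s}|lborel. heat r (G'' s) x)"
      using heat_increment[OF G(1) G(2) cG'' Gb(1) Gb(2) Gb(3), of "t - _" _ x]
      by (intro set_integrable_cong) (auto simp: algebra_simps)
    finally show "set_integrable lborel {0..t} (\<lambda>s. LINT r:{0..t - s}|lborel. heat r (G'' s) x)" .
  qed
  also have "(LINT s:{0..t}|lborel. LINT r:{0..t - s}|lborel. heat r (G'' s) x) = (LINT r:{0..t}|lborel. ?I r)"
    using triangle_integral_swap[OF cK abs_heat_le[OF Gb(3)] t] .
  finally have D: "(LINT s:{0..t}|lborel. heat (t - s) (G s) x) =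
      (LINT s:{0..t}|lborel. G s x) + (LINT r:{0..t}|lborel. ?I r)" .
  have "(LINT r:{0..t}|lborel. duhamel r h'' G'' x + G r x) =
      (LINT r:{0..t}|lborel. heat r h'' x) + (LINT r:{0..t}|lborel. ?I r) + (LINT s:{0..t}|lborel. G s x)"
    unfolding duhamel_def
    by (subst set_integral_add(2) | intro si continuous_intros set_integral_add(1)
        cI continuous_on_subset[OF ch] continuous_on_subset[OF cG] | simp)+
  then show ?thesis
    using heat_increment[OF h hb t, of x] D by (simp add: duhamel_def)
qed

lemma duhamel_has_time_derivative:
  assumes h: "\<And>y. (h has_real_derivative h' y) (at y)" "\<And>y. (h' has_real_derivative h'' y) (at y)"
    "continuous_on UNIV h''"
    and hb: "\<And>y. \<bar>h y\<bar> \<le> B" "\<And>y. \<bar>h' y\<bar> \<le> B" "\<And>y. \<bar>h'' y\<bar> \<le> B"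
    and G: "\<And>s y. (G s has_real_derivative G' s y) (at y)" "\<And>s y. (G' s has_real_derivative G'' s y) (at y)"
    and Gc: "continuous_on UNIV (\<lambda>(s, y). G s y)" "continuous_on UNIV (\<lambda>(s, y). G'' s y)"
    and Gb: "\<And>s y. \<bar>G s y\<bar> \<le> B" "\<And>s y. \<bar>G' s y\<bar> \<le> B" "\<And>s y. \<bar>G'' s y\<bar> \<le> B"
    and cont: "continuous_on {0..\<tau>} (\<lambda>r. duhamel r h'' G'' x)"
    and t: "0 < t" "t < \<tau>"
  shows "((\<lambda>s. duhamel s h G x) has_real_derivative duhamel t h'' G'' x + G t x) (at t)"
proof -
  let ?k = "\<lambda>r. duhamel r h'' G'' x + G r x"
  have cG: "continuous_on UNIV (\<lambda>s. G s x)"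
    by (intro continuous_on_compose_pair[OF Gc(1)] continuous_intros)
  have ck: "continuous_on {0..\<tau>} ?k"
    by (intro continuous_on_add cont continuous_on_subset[OF cG]) auto
  have "((\<lambda>s. integral {0..s} ?k) has_real_derivative ?k t) (at t within {0..\<tau>})"
    using integral_has_vector_derivative[OF ck, of t] t
    by (simp add: has_real_derivative_iff_has_vector_derivative)
  then have d: "((\<lambda>s. h x + integral {0..s} ?k) has_real_derivative ?k t) (at t)"
    using t by (auto intro!: derivative_eq_intros simp: at_within_Icc_at)
  show ?thesis
  proof (rule DERIV_cong_ev[THEN iffD2, OF refl _ refl d])
    have "eventually (\<lambda>s. s \<in> {0<..<\<tau>}) (nhds t)" using t by (intro eventually_nhds_in_open) auto
    then show "\<forall>\<^sub>F s in nhds t. duhamel s h G x = h x + integral {0..s} ?k"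
    proof eventually_elim
      case (elim s)
      have "duhamel s h G x = h x + (LINT r:{0..s}|lborel. ?k r)"
        using elim by (intro duhamel_increment[OF h hb G Gc Gb] continuous_on_subset[OF cont]) auto
      also have "(LINT r:{0..s}|lborel. ?k r) = integral {0..s} ?k"
        using elim by (intro set_borel_integral_eq_integral borel_integrable_atLeastAtMost' continuous_on_subset[OF ck]) auto
      finally show ?case .
    qed
  qed
qed

section \<open>Mild solutions by contraction\<close>

definition duhamel_measure :: "(real \<times> real) measure" where
  "duhamel_measure = uniform_measure lborel {0..1} \<Otimes>\<^sub>M gauss"

lemma prob_space_uniform_unit: "prob_space (uniform_measure lborel {0..1::real})"
  by (rule prob_space_uniform_measure) auto

lemma prob_space_duhamel_measure: "prob_space duhamel_measure"
proof -
  interpret pair_prob_space "uniform_measure lborel {0..1::real}" gauss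
    by (simp add: pair_prob_space_def pair_sigma_finite_def prob_space_uniform_unit prob_space_gauss
        prob_space_imp_sigma_finite)
  show ?thesis unfolding duhamel_measure_def by (rule P.prob_space_axioms)
qed

lemma sets_duhamel_measure [simp, measurable_cong]: "sets duhamel_measure = sets borel"
proof -
  have "sets duhamel_measure = sets ((borel :: real measure) \<Otimes>\<^sub>M (borel :: real measure))"
    unfolding duhamel_measure_def by (intro sets_pair_measure_cong) auto
  then show ?thesis unfolding borel_prod .
qed

lemma borel_measurable_duhamel_measure:
  assumes "continuous_on UNIV g"
  shows "g \<in> borel_measurable duhamel_measure"
  using borel_measurable_continuous_onI[OF assms] by (simp cong: measurable_cong_sets)

lemma integrable_duhamel_measure:
  fixes g :: "real \<times> real \<Rightarrow> 'e::{banach, second_countable_topology}"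
  assumes "continuous_on UNIV g" "\<And>w. norm (g w) \<le> B"
  shows "integrable duhamel_measure g"
proof -
  interpret prob_space duhamel_measure by (rule prob_space_duhamel_measure)
  show ?thesis
    using assms by (intro integrable_const_bound[where B=B] borel_measurable_duhamel_measure) auto
qed

lemma norm_integral_duhamel_measure_le:
  fixes g :: "real \<times> real \<Rightarrow> 'e::{banach, second_countable_topology}"
  assumes "continuous_on UNIV g" "\<And>w. norm (g w) \<le> B"
  shows "norm (integral\<^sup>L duhamel_measure g) \<le> B"
proof -
  interpret prob_space duhamel_measure by (rule prob_space_duhamel_measure)
  have "norm (integral\<^sup>L duhamel_measure g) \<le> (\<integral>w. norm (g w) \<partial>duhamel_measure)"
    by (rule integral_norm_bound)
  also have "\<dots> \<le> (\<integral>w. B \<partial>duhamel_measure)"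
    by (rule integral_mono) (use integrable_duhamel_measure[OF assms] assms in auto)
  finally show ?thesis using prob_space by simp
qed

text \<open>
  Substituting \<open>s = t \<theta>\<close> with \<open>\<theta>\<close> uniform in the unit interval writes Duhamel's formula as a
  single expectation over the pair \<open>(\<theta>, z)\<close>, with a law that does not depend on \<open>(t, x)\<close>. Continuity, differentiability in
  \<open>x\<close> and the contraction estimate can then be read off from the integrand.
\<close>

definition duhamel_integrand ::
  "(real \<Rightarrow> 'e::real_normed_vector) \<Rightarrow> (real \<Rightarrow> real \<Rightarrow> 'e) \<Rightarrow> real \<Rightarrow> real \<Rightarrow> real \<times> real \<Rightarrow> 'e" where
  "duhamel_integrand h G t x w =
     h (x + sqrt (2 * t) * snd w) + t *\<^sub>R G (t * fst w) (x + sqrt (2 * (t * (1 - fst w))) * snd w)"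

lemma continuous_on_duhamel_integrand:
  assumes h: "continuous_on UNIV h" and G: "continuous_on UNIV (\<lambda>(s, y). G s y)"
    and "continuous_on S t" "continuous_on S x" "continuous_on S w"
  shows "continuous_on S (\<lambda>p. duhamel_integrand h G (t p) (x p) (w p))"
  unfolding duhamel_integrand_def
  by (intro continuous_intros continuous_on_compose_pair[OF G] continuous_on_compose2[OF h] assms) auto

lemma norm_duhamel_integrand_le:
  assumes "\<And>y. norm (h y) \<le> A" "\<And>s y. norm (G s y) \<le> C" "0 \<le> t"
  shows "norm (duhamel_integrand h G t x w) \<le> A + t * C"
  unfolding duhamel_integrand_def using assms
  by (intro order_trans[OF norm_triangle_ineq] add_mono) (auto intro!: mult_left_mono)

lemma integral_duhamel_integrand:
  fixes h :: "real \<Rightarrow> real"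
  assumes h: "continuous_on UNIV h" "\<And>y. \<bar>h y\<bar> \<le> B"
    and G: "continuous_on UNIV (\<lambda>(s, y). G s y)" "\<And>s y. \<bar>G s y\<bar> \<le> B"
    and t: "0 \<le> t"
  shows "(\<integral>w. duhamel_integrand h G t x w \<partial>duhamel_measure) = duhamel t h G x"
proof -
  interpret pair_prob_space "uniform_measure lborel {0..1::real}" gauss
    by (simp add: pair_prob_space_def pair_sigma_finite_def prob_space_uniform_unit prob_space_gauss
        prob_space_imp_sigma_finite)
  have int: "integrable duhamel_measure (duhamel_integrand h G t x)"
    using continuous_on_duhamel_integrand[OF h(1) G(1), of UNIV "\<lambda>_. t" "\<lambda>_. x" "\<lambda>w. w"]
      norm_duhamel_integrand_le[of h B G B t x] h G t
    by (intro integrable_duhamel_measure[where B="B + t * B"]) auto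
  have ch: "continuous_on UNIV (\<lambda>z. h (x + c * z))" for c
    by (intro continuous_on_compose2[OF h(1)] continuous_intros) auto
  have cG: "continuous_on UNIV (\<lambda>z. G s (x + c * z))" for s c
    by (intro continuous_on_compose_pair[OF G(1)] continuous_intros)
  have inner: "(\<integral>z. duhamel_integrand h G t x (\<theta>, z) \<partial>gauss) = heat t h x + t * heat (t * (1 - \<theta>)) (G (t * \<theta>)) x" for \<theta>
    unfolding duhamel_integrand_def heat_def
    using integrable_gauss_bounded[OF borel_measurable_continuous_onI[OF ch] h(2)]
      integrable_gauss_bounded[OF borel_measurable_continuous_onI[OF cG] G(2)]
    by simp
  define k where "k \<theta> = heat (t - \<theta>) (G \<theta>) x" for \<theta>
  have kc: "continuous_on UNIV k"
    unfolding k_def by (rule continuous_on_heat[OF G]) (auto intro!: continuous_intros)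
  have kb: "\<bar>k \<theta>\<bar> \<le> B" for \<theta> unfolding k_def by (rule abs_heat_le[OF G(2)])
  have ktc: "continuous_on UNIV (\<lambda>\<theta>. k (t * \<theta>))"
    by (intro continuous_on_compose2[OF kc] continuous_intros) auto
  have [measurable]: "k \<in> borel_measurable borel" using kc by (rule borel_measurable_continuous_onI)
  have "(\<integral>w. duhamel_integrand h G t x w \<partial>duhamel_measure)
      = (\<integral>\<theta>. (\<integral>z. duhamel_integrand h G t x (\<theta>, z) \<partial>gauss) \<partial>uniform_measure lborel {0..1})"
    using integral_fst'[of "duhamel_integrand h G t x"] int by (simp add: duhamel_measure_def)
  also have "\<dots> = (\<integral>\<theta>. heat t h x + t * k (t * \<theta>) \<partial>uniform_measure lborel {0..1})"
    unfolding inner by (simp add: k_def algebra_simps)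
  also have "\<dots> = heat t h x + t * (\<integral>\<theta>. k (t * \<theta>) \<partial>uniform_measure lborel {0..1})"
  proof -
    have "integrable (uniform_measure lborel {0..1}) (\<lambda>\<theta>. k (t * \<theta>))"
      by (intro M1.integrable_const_bound[where B=B]) (use kb in auto)
    then show ?thesis using M1.prob_space by simp
  qed
  also have "t * (\<integral>\<theta>. k (t * \<theta>) \<partial>uniform_measure lborel {0..1}) = (LINT s:{0..t}|lborel. k s)"
  proof (cases "t = 0")
    case True
    then show ?thesis using set_integral_point[of 0 k] by simp
  next
    case False
    with t have t: "0 < t" by simp
    have "uniform_measure lborel {0..1} = density lborel (\<lambda>\<theta>. ennreal (indicator {0..1::real} \<theta>))"
      unfolding uniform_measure_def by (intro density_cong) (auto simp: indicator_def)
    then have "(\<integral>\<theta>. k (t * \<theta>) \<partial>uniform_measure lborel {0..1}) = (\<integral>\<theta>. indicator {0..1} \<theta> * k (t * \<theta>) \<partial>lborel)"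
      by (simp add: integral_density)
    moreover have "(LINT s:{0..t}|lborel. k s) = t * (\<integral>\<theta>. indicator {0..t} (0 + t * \<theta>) * k (0 + t * \<theta>) \<partial>lborel)"
      using t unfolding set_lebesgue_integral_def
      by (subst lborel_integral_real_affine[where c=t and t=0]) auto
    moreover have "(\<integral>\<theta>. indicator {0..t} (0 + t * \<theta>) * k (0 + t * \<theta>) \<partial>lborel) = (\<integral>\<theta>. indicator {0..1} \<theta> * k (t * \<theta>) \<partial>lborel)"
      using t by (intro Bochner_Integration.integral_cong) (auto simp: indicator_def zero_le_mult_iff mult_le_cancel_left1)
    ultimately show ?thesis by simp
  qed
  finally show ?thesis by (simp add: duhamel_def k_def)
qed

lemma integral_duhamel_integrand_has_derivative:
  fixes h :: "real \<Rightarrow> real"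
  assumes h: "\<And>y. (h has_real_derivative h' y) (at y)" "continuous_on UNIV h'"
    "\<And>y. \<bar>h y\<bar> \<le> B" "\<And>y. \<bar>h' y\<bar> \<le> B"
    and G: "\<And>s y. (G s has_real_derivative G' s y) (at y)"
    "continuous_on UNIV (\<lambda>(s, y). G s y)" "continuous_on UNIV (\<lambda>(s, y). G' s y)"
    "\<And>s y. \<bar>G s y\<bar> \<le> B" "\<And>s y. \<bar>G' s y\<bar> \<le> B"
    and t: "0 \<le> t"
  shows "((\<lambda>x. \<integral>w. duhamel_integrand h G t x w \<partial>duhamel_measure) has_real_derivative
          (\<integral>w. duhamel_integrand h' G' t x w \<partial>duhamel_measure)) (at x)"
proof (rule has_real_derivative_param_integral[where S=UNIV and B="\<lambda>_. B + t * B"])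
  have ch: "continuous_on UNIV h"
    using h(1) by (auto intro!: DERIV_continuous_on intro: has_field_derivative_at_within)
  show "integrable duhamel_measure (duhamel_integrand h G t y)" for y
    using continuous_on_duhamel_integrand[OF ch G(2), of UNIV "\<lambda>_. t" "\<lambda>_. y" "\<lambda>w. w"]
      norm_duhamel_integrand_le[of h B G B t y] h G t
    by (intro integrable_duhamel_measure[where B="B + t * B"]) auto
  show "duhamel_integrand h' G' t x \<in> borel_measurable duhamel_measure"
    using continuous_on_duhamel_integrand[OF h(2) G(3), of UNIV "\<lambda>_. t" "\<lambda>_. x" "\<lambda>w. w"]
    by (intro borel_measurable_duhamel_measure) auto
  show "((\<lambda>y. duhamel_integrand h G t y w) has_real_derivative duhamel_integrand h' G' t y w) (at y)" for w y
    unfolding duhamel_integrand_def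
    by (auto intro!: derivative_eq_intros DERIV_chain2[OF h(1)] DERIV_chain2[OF G(1)])
  show "\<bar>duhamel_integrand h' G' t y w\<bar> \<le> B + t * B" for w y
    using norm_duhamel_integrand_le[of h' B G' B t y w] h G t by auto
  interpret prob_space duhamel_measure by (rule prob_space_duhamel_measure)
  show "integrable duhamel_measure (\<lambda>_. B + t * B)" by simp
qed auto

text \<open>
  Time is truncated to \<open>{0..\<tau>}\<close>, so that the map acts on the Banach space of bounded continuous functions
  on the whole plane.
\<close>

definition mild_map ::
  "real \<Rightarrow> (real \<Rightarrow> 'e::{banach, second_countable_topology}) \<Rightarrow> (real \<Rightarrow> 'e \<Rightarrow> 'e) \<Rightarrow> (real \<times> real \<Rightarrow> 'e) \<Rightarrow> real \<times> real \<Rightarrow> 'e"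
  where
  "mild_map \<tau> H Q U p =
    (\<integral>w. duhamel_integrand H (\<lambda>s y. Q y (U (s, y))) (max 0 (min \<tau> (fst p))) (snd p) w \<partial>duhamel_measure)"

text \<open>
  The closed set \<open>D\<close> is a placeholder for side conditions that the iteration preserves; below it
  says that the components of the triple are derivatives of each other.
\<close>

lemma mild_solution_exists:
  fixes H :: "real \<Rightarrow> 'e::{banach, second_countable_topology}"
  assumes H: "continuous_on UNIV H" "\<And>y. norm (H y) \<le> M"
    and Q: "continuous_on UNIV (\<lambda>(y, e). Q y e)" "\<And>y. Q y 0 = 0"
    and lip: "\<And>y a b. norm a \<le> M + 1 \<Longrightarrow> norm b \<le> M + 1 \<Longrightarrow> norm (Q y a - Q y b) \<le> L * norm (a - b)"
    and \<tau>: "0 < \<tau>" "\<tau> * (L * (M + 1)) \<le> 1 / 2" and L: "0 \<le> L"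
    and D: "closed D" "0 \<in> D"
    and inv: "\<And>U V. U \<in> D \<Longrightarrow> norm U \<le> M + 1 \<Longrightarrow> (\<And>p. apply_bcontfun V p = mild_map \<tau> H Q (apply_bcontfun U) p) \<Longrightarrow> V \<in> D"
  obtains U where "U \<in> D" "norm U \<le> M + 1" "\<And>p. apply_bcontfun U p = mild_map \<tau> H Q (apply_bcontfun U) p"
proof -
  have M: "0 \<le> M" using H(2)[of 0] norm_ge_zero order_trans by blast
  let ?c = "\<lambda>t. max 0 (min \<tau> t)"
  let ?S = "D \<inter> cball 0 (M + 1)"
  have cQ: "continuous_on UNIV (\<lambda>(s, y). Q y (apply_bcontfun U (s, y)))" for U
    unfolding case_prod_beta
    by (intro continuous_on_compose_pair[OF Q(1)] continuous_intros continuous_on_compose2[OF continuous_on_apply_bcontfun[of UNIV U]]) auto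
  have Ub: "norm (apply_bcontfun U p) \<le> M + 1" if "norm U \<le> M + 1" for U p
    using norm_bounded[of U p] that by linarith
  have Qb: "norm (Q y a) \<le> L * (M + 1)" if "norm a \<le> M + 1" for y a
  proof -
    have "norm (Q y a) \<le> L * norm a" using lip[of a 0 y] that M Q(2) by simp
    also have "\<dots> \<le> L * (M + 1)" using that L by (intro mult_left_mono)
    finally show ?thesis .
  qed
  have cont: "continuous_on UNIV (\<lambda>p. duhamel_integrand H (\<lambda>s y. Q y (apply_bcontfun U (s, y))) (?c (fst p)) (snd p) w)" for U w
    by (intro continuous_on_duhamel_integrand[OF H(1) cQ] continuous_intros)
  have cont': "continuous_on UNIV (duhamel_integrand H (\<lambda>s y. Q y (apply_bcontfun U (s, y))) t x)" for U t x
    by (intro continuous_on_duhamel_integrand[OF H(1) cQ] continuous_intros)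
  have ib: "norm (duhamel_integrand H (\<lambda>s y. Q y (apply_bcontfun U (s, y))) (?c t) x w) \<le> M + 1"
    if U: "norm U \<le> M + 1" for U w t x
  proof -
    have "norm (duhamel_integrand H (\<lambda>s y. Q y (apply_bcontfun U (s, y))) (?c t) x w) \<le> M + ?c t * (L * (M + 1))"
      using Ub[OF U] by (intro norm_duhamel_integrand_le H Qb) auto
    also have "?c t * (L * (M + 1)) \<le> \<tau> * (L * (M + 1))"
      using L M \<tau> by (intro mult_right_mono) auto
    finally show ?thesis using \<tau>(2) by simp
  qed
  have bc: "mild_map \<tau> H Q (apply_bcontfun U) \<in> bcontfun" if U: "norm U \<le> M + 1" for U
  proof (rule bcontfun_normI)
    show "continuous_on UNIV (mild_map \<tau> H Q (apply_bcontfun U))"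
      unfolding mild_map_def[abs_def]
      using prob_space.finite_measure[OF prob_space_duhamel_measure] cont cont' ib[OF U]
      by (intro continuous_on_param_integral[where B="M+1"] borel_measurable_duhamel_measure)
    show "norm (mild_map \<tau> H Q (apply_bcontfun U) p) \<le> M + 1" for p
      unfolding mild_map_def by (intro norm_integral_duhamel_measure_le cont' ib[OF U])
  qed
  let ?F = "\<lambda>U. Bcontfun (mild_map \<tau> H Q (apply_bcontfun U))"
  have app: "apply_bcontfun (?F U) p = mild_map \<tau> H Q (apply_bcontfun U) p" if "norm U \<le> M + 1" for U p
    using bc[OF that] by (simp add: Bcontfun_inverse)
  have "closed ?S" using D(1) by (simp add: closed_Int)
  have "\<exists>!U\<in>?S. ?F U = U"
  proof (rule Banach_fix[where c="1/2", OF complete_eq_closed[THEN iffD2, OF \<open>closed ?S\<close>]])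
    show "?S \<noteq> {}" using D(2) M by (intro ex_in_conv[THEN iffD1] exI[of _ 0]) auto
    show "?F ` ?S \<subseteq> ?S"
    proof safe
      fix U assume U: "U \<in> D" "U \<in> cball 0 (M + 1)"
      then have n: "norm U \<le> M + 1" by simp
      show "?F U \<in> D" by (rule inv[OF U(1) n app[OF n]])
      have "norm (?F U) \<le> M + 1"
        by (rule norm_bound)
          (unfold app[OF n] mild_map_def, intro norm_integral_duhamel_measure_le cont' ib[OF n])
      then show "?F U \<in> cball 0 (M + 1)" by simp
    qed
    fix U V assume UV: "U \<in> ?S" "V \<in> ?S"
    then have n: "norm U \<le> M + 1" "norm V \<le> M + 1" by auto
    show "dist (?F U) (?F V) \<le> 1 / 2 * dist U V"
    proof (rule dist_bound)
      fix p :: "real \<times> real"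
      let ?d = "\<lambda>W. duhamel_integrand H (\<lambda>s y. Q y (apply_bcontfun W (s, y))) (?c (fst p)) (snd p)"
      have "dist (?F U p) (?F V p) = norm (\<integral>w. ?d U w - ?d V w \<partial>duhamel_measure)"
        unfolding app[OF n(1)] app[OF n(2)] mild_map_def dist_norm
        by (subst Bochner_Integration.integral_diff) (auto intro!: integrable_duhamel_measure cont' ib n)
      also have "\<dots> \<le> 1 / 2 * dist U V"
      proof (rule norm_integral_duhamel_measure_le)
        show "continuous_on UNIV (\<lambda>w. ?d U w - ?d V w)" by (intro continuous_intros cont')
        fix w
        define s y where "s = ?c (fst p) * fst w" and "y = snd p + sqrt (2 * (?c (fst p) * (1 - fst w))) * snd w"
        have "norm (?d U w - ?d V w) = ?c (fst p) * norm (Q y (U (s, y)) - Q y (V (s, y)))"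
          by (simp add: duhamel_integrand_def s_def y_def flip: scaleR_diff_right)
        also have "\<dots> \<le> \<tau> * (L * dist U V)"
        proof (intro mult_mono)
          have "norm (Q y (U (s, y)) - Q y (V (s, y))) \<le> L * norm (U (s, y) - V (s, y))"
            by (intro lip Ub n)
          also have "\<dots> \<le> L * dist U V"
            using L dist_bounded[of U "(s, y)" V] by (intro mult_left_mono) (auto simp: dist_norm)
          finally show "norm (Q y (U (s, y)) - Q y (V (s, y))) \<le> L * dist U V" .
        qed (use \<tau> L in auto)
        also have "\<tau> * (L * dist U V) = \<tau> * L * dist U V" by simp
        also have "\<dots> \<le> 1 / 2 * dist U V"
        proof (intro mult_right_mono)
          have "\<tau> * L * 1 \<le> \<tau> * L * (M + 1)" using \<tau> L M by (intro mult_left_mono) auto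
          then show "\<tau> * L \<le> 1 / 2" using \<tau>(2) by (simp only: mult.assoc mult_1_right)
        qed simp
        finally show "norm (?d U w - ?d V w) \<le> 1 / 2 * dist U V" .
      qed
      finally show "dist (?F U p) (?F V p) \<le> 1 / 2 * dist U V" .
    qed
  qed auto
  then obtain U where "U \<in> D" "norm U \<le> M + 1" "?F U = U" by auto
  then show ?thesis using that app by metis
qed

section \<open>Local existence with time depending on the supremum norm\<close>

definition C2_bounded :: "(real \<Rightarrow> real) \<Rightarrow> bool" where
  "C2_bounded g \<longleftrightarrow>
     (\<forall>x. (g has_real_derivative deriv g x) (at x)) \<and>
     (\<forall>x. (deriv g has_real_derivative deriv (deriv g) x) (at x)) \<and>
     continuous_on UNIV (deriv (deriv g)) \<and>
     (\<exists>B. \<forall>x. \<bar>g x\<bar> \<le> B \<and> \<bar>deriv g x\<bar> \<le> B \<and> \<bar>deriv (deriv g) x\<bar> \<le> B)"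

text \<open>
  Classical solutions that in addition have two bounded spatial derivatives at every time,
  the initial one included. They can be restarted at every time, which makes this the convenient
  class for continuation.
\<close>

definition strip_solution :: "(real \<Rightarrow> real) \<Rightarrow> real \<Rightarrow> (real \<Rightarrow> real \<Rightarrow> real) \<Rightarrow> bool" where
  "strip_solution f T u \<longleftrightarrow>
     continuous_on ({0..<T} \<times> UNIV) (\<lambda>(t, x). u t x) \<and>
     continuous_on ({0..<T} \<times> UNIV) (\<lambda>(t, x). deriv (u t) x) \<and>
     continuous_on ({0..<T} \<times> UNIV) (\<lambda>(t, x). deriv (deriv (u t)) x) \<and>
     (\<forall>t\<in>{0..<T}. C2_bounded (u t)) \<and>
     (\<forall>\<tau>\<in>{0..<T}. \<exists>B. \<forall>t\<in>{0..\<tau>}. \<forall>x. \<bar>u t x\<bar> \<le> B) \<and>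
     (\<forall>t\<in>{0<..<T}. \<forall>x. ((\<lambda>s. u s x) has_real_derivative
        deriv (deriv (u t)) x - 2 * f x * u t x - (u t x)\<^sup>2) (at t))"

text \<open>
  The reaction term \<open>- 2 f a - a^2\<close> with its first two derivatives along a function with the values
  \<open>a\<close>, \<open>b / \<delta>\<close>, \<open>c / \<delta>^2\<close> of itself and its derivatives, again weighted by \<open>1\<close>, \<open>\<delta>\<close>, \<open>\<delta>^2\<close>.
  The weights are distributed so that only nonnegative powers of \<open>\<delta>\<close> remain.
\<close>

fun reaction_jet :: "(real \<Rightarrow> real) \<Rightarrow> real \<Rightarrow> real \<Rightarrow> real \<times> real \<times> real \<Rightarrow> real \<times> real \<times> real" where
  "reaction_jet f \<delta> y (a, b, c) =
    (- 2 * f y * a - a\<^sup>2,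
     - 2 * (\<delta> * deriv f y) * a - 2 * f y * b - 2 * a * b,
     - 2 * (\<delta>\<^sup>2 * deriv (deriv f) y) * a - 4 * (\<delta> * deriv f y) * b - 2 * f y * c - 2 * b\<^sup>2 - 2 * a * c)"

text \<open>
  The constant is independent of \<open>\<delta>\<close>. This is what allows \<open>\<delta>\<close> to be adapted to the derivatives of
  the initial datum at no cost in the existence time. The number 14 adds up the coefficients
  of the three components, both for the terms with \<open>f\<close> and for the products.
\<close>

lemma reaction_jet_lipschitz:
  assumes f: "\<And>y. \<bar>f y\<bar> \<le> K" "\<And>y. \<bar>deriv f y\<bar> \<le> K" "\<And>y. \<bar>deriv (deriv f) y\<bar> \<le> K"
    and \<delta>: "0 < \<delta>" "\<delta> \<le> 1" and p: "norm p \<le> R" and q: "norm q \<le> R"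
  shows "norm (reaction_jet f \<delta> y p - reaction_jet f \<delta> y q) \<le> 14 * (K + R) * norm (p - q)"
proof -
  obtain a b c where pe: "p = (a, b, c)" by (cases p) auto
  obtain a' b' c' where qe: "q = (a', b', c')" by (cases q) auto
  define d where "d = norm (p - q)"
  have comp: "\<bar>u\<bar> \<le> norm (u, v, w) \<and> \<bar>v\<bar> \<le> norm (u, v, w) \<and> \<bar>w\<bar> \<le> norm (u, v, w)" for u v w :: real
    using norm_fst_le[of u "(v, w)"] norm_snd_le[of "(v, w)" u] norm_fst_le[of v w] norm_snd_le[of w v] by auto
  have ps: "\<bar>a\<bar> \<le> R" "\<bar>b\<bar> \<le> R" "\<bar>c\<bar> \<le> R" using comp[of a b c] p by (auto simp: pe)
  have qs: "\<bar>a'\<bar> \<le> R" "\<bar>b'\<bar> \<le> R" "\<bar>c'\<bar> \<le> R" using comp[of a' b' c'] q by (auto simp: qe)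
  have ds: "\<bar>a - a'\<bar> \<le> d" "\<bar>b - b'\<bar> \<le> d" "\<bar>c - c'\<bar> \<le> d"
    using comp[of "a - a'" "b - b'" "c - c'"] by (auto simp: pe qe d_def)
  have d: "0 \<le> d" and R: "0 \<le> R" using ds ps by linarith+
  have mlin: "\<bar>k * u - k * v\<bar> \<le> K * d" if "\<bar>k\<bar> \<le> K" "\<bar>u - v\<bar> \<le> d" for k u v :: real
    using mult_mono[OF that] that by (simp add: abs_mult flip: right_diff_distrib)
  have mprod: "\<bar>u * v - u' * v'\<bar> \<le> 2 * R * d"
    if "\<bar>u\<bar> \<le> R" "\<bar>v'\<bar> \<le> R" "\<bar>u - u'\<bar> \<le> d" "\<bar>v - v'\<bar> \<le> d" for u v u' v' :: real
  proof -
    have "u * v - u' * v' = u * (v - v') + (u - u') * v'" by (simp add: algebra_simps)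
    also have "\<bar>\<dots>\<bar> \<le> \<bar>u\<bar> * \<bar>v - v'\<bar> + \<bar>u - u'\<bar> * \<bar>v'\<bar>"
      by (rule order_trans[OF abs_triangle_ineq]) (simp add: abs_mult)
    also have "\<dots> \<le> R * d + d * R" using that d R by (intro add_mono mult_mono) auto
    finally show ?thesis by simp
  qed
  define k0 k1 k2 where "k0 = f y" and "k1 = \<delta> * deriv f y" and "k2 = \<delta>\<^sup>2 * deriv (deriv f) y"
  have k: "\<bar>k0\<bar> \<le> K" "\<bar>k1\<bar> \<le> K" "\<bar>k2\<bar> \<le> K"
  proof -
    show "\<bar>k0\<bar> \<le> K" using f by (simp add: k0_def)
    have "\<bar>k1\<bar> \<le> 1 * K" unfolding k1_def abs_mult using f \<delta> by (intro mult_mono) auto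
    then show "\<bar>k1\<bar> \<le> K" by simp
    have "\<bar>k2\<bar> \<le> 1 * K" unfolding k2_def abs_mult using f \<delta>
      by (intro mult_mono) (auto simp: power_le_one)
    then show "\<bar>k2\<bar> \<le> K" by simp
  qed
  define e where "e = reaction_jet f \<delta> y p - reaction_jet f \<delta> y q"
  have e1: "\<bar>fst e\<bar> \<le> 2 * (K * d) + 2 * R * d"
    using mlin[OF k(1) ds(1)] mprod[OF ps(1) qs(1) ds(1) ds(1)]
    unfolding e_def pe qe by (simp add: power2_eq_square mult.assoc flip: k0_def)
  have e2: "\<bar>fst (snd e)\<bar> \<le> 4 * (K * d) + 2 * (2 * R * d)"
    using mlin[OF k(2) ds(1)] mlin[OF k(1) ds(2)] mprod[OF ps(1) qs(2) ds(1) ds(2)]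
    unfolding e_def pe qe by (simp add: mult.assoc flip: k0_def k1_def)
  have e3: "\<bar>snd (snd e)\<bar> \<le> 8 * (K * d) + 4 * (2 * R * d)"
    using mlin[OF k(3) ds(1)] mlin[OF k(2) ds(2)] mlin[OF k(1) ds(3)] mprod[OF ps(2) qs(2) ds(2) ds(2)] mprod[OF ps(1) qs(3) ds(1) ds(3)]
    unfolding e_def pe qe reaction_jet.simps k0_def[symmetric] k1_def[symmetric] k2_def[symmetric]
    by (simp add: power2_eq_square mult.assoc)
  have "norm e \<le> \<bar>fst e\<bar> + (\<bar>fst (snd e)\<bar> + \<bar>snd (snd e)\<bar>)"
    using norm_Pair_le[of "fst e" "snd e"] norm_Pair_le[of "fst (snd e)" "snd (snd e)"] by simp
  also have "\<dots> \<le> 14 * (K + R) * d" using e1 e2 e3 by (simp add: algebra_simps)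
  finally show ?thesis by (simp add: e_def d_def)
qed

lemma continuous_on_reaction_jet:
  assumes f: "C2_bounded f"
  shows "continuous_on UNIV (\<lambda>(y, e). reaction_jet f \<delta> y e)"
proof -
  have c: "continuous_on UNIV f" "continuous_on UNIV (deriv f)" "continuous_on UNIV (deriv (deriv f))"
    using f by (auto simp: C2_bounded_def intro!: DERIV_continuous_on[of _ _ "deriv _"] intro: has_field_derivative_at_within)
  have "continuous_on UNIV (\<lambda>p. reaction_jet f \<delta> (fst p) (fst (snd p), fst (snd (snd p)), snd (snd (snd p))))"
    unfolding reaction_jet.simps
    by (intro continuous_intros continuous_on_compose2[OF c(1)] continuous_on_compose2[OF c(2)] continuous_on_compose2[OF c(3)]) auto
  then show ?thesis by (simp add: case_prod_beta)
qed

text \<open>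
  Being a derivative is closed under uniform convergence.
\<close>

lemma closed_derivative_relation:
  fixes p q :: "'e::real_normed_vector \<Rightarrow> real"
  assumes p: "bounded_linear p" and q: "bounded_linear q"
  shows "closed {U :: (real \<times> real) \<Rightarrow>\<^sub>C 'e. \<forall>t x. ((\<lambda>y. p (U (t, y))) has_real_derivative q (U (t, x))) (at x)}"
    (is "closed ?D")
  unfolding closed_sequential_limits
proof (intro allI impI, elim conjE)
  fix X and U :: "(real \<times> real) \<Rightarrow>\<^sub>C 'e" assume X: "\<forall>n. X n \<in> ?D" and lim: "X \<longlonglongrightarrow> U"
  interpret p: bounded_linear p by fact
  interpret q: bounded_linear q by fact
  have pl: "(\<lambda>n. X n w) \<longlonglongrightarrow> U w" for w
    using tendsto_uniform_limitI[OF tendsto_bcontfun_uniform_limit[OF lim], of w] by simp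
  obtain K where K: "0 < K" "\<And>v. norm (q v) \<le> norm v * K" using q.pos_bounded by blast
  show "U \<in> ?D"
  proof (intro CollectI allI)
    fix t x
    have "\<exists>g. \<forall>x\<in>UNIV. (\<lambda>n. p (X n (t, x))) \<longlonglongrightarrow> g x \<and> (g has_derivative (*) (q (U (t, x)))) (at x within UNIV)"
    proof (rule has_derivative_sequence[where f'="\<lambda>n x. (*) (q (X n (t, x)))" and ?x0.0=0])
      show "((\<lambda>x. p (X n (t, x))) has_derivative (*) (q (X n (t, x)))) (at x within UNIV)" for n x
        using X by (auto simp: has_field_derivative_def)
      show "(\<lambda>n. p (X n (t, 0))) \<longlonglongrightarrow> p (U (t, 0))" by (intro p.tendsto pl)
      fix e :: real assume e: "0 < e"
      have "\<forall>\<^sub>F n in sequentially. dist (X n) U < e / K"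
        using e K by (intro tendstoD[OF lim]) simp
      then show "\<forall>\<^sub>F n in sequentially. \<forall>x\<in>UNIV. \<forall>h. norm (q (X n (t, x)) * h - q (U (t, x)) * h) \<le> e * norm h"
      proof eventually_elim
        case (elim n)
        show ?case
        proof (intro ballI allI)
          fix x h :: real
          have "norm (q (X n (t, x)) - q (U (t, x))) \<le> norm (X n (t, x) - U (t, x)) * K"
            using K(2) by (simp flip: q.diff)
          also have "\<dots> \<le> e / K * K"
            using elim dist_bounded[of "X n" "(t, x)" U] K(1) by (intro mult_right_mono) (auto simp: dist_norm)
          finally have "norm (q (X n (t, x)) - q (U (t, x))) * norm h \<le> e * norm h"
            using K(1) by (intro mult_right_mono) auto
          then show "norm (q (X n (t, x)) * h - q (U (t, x)) * h) \<le> e * norm h"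
            by (simp add: abs_mult flip: left_diff_distrib)
        qed
      qed
    qed auto
    then obtain g where g: "\<And>x. (\<lambda>n. p (X n (t, x))) \<longlonglongrightarrow> g x" "\<And>x. (g has_derivative (*) (q (U (t, x)))) (at x)"
      by auto
    have "g = (\<lambda>y. p (U (t, y)))"
      using LIMSEQ_unique[OF g(1) p.tendsto[OF pl]] by auto
    then show "((\<lambda>y. p (U (t, y))) has_real_derivative q (U (t, x))) (at x)"
      using g(2)[of x] by (simp add: has_field_derivative_def)
  qed
qed


lemma bounded_linear_duhamel_integral:
  fixes H :: "real \<Rightarrow> 'e::{banach, second_countable_topology}" and T :: "'e \<Rightarrow> real"
  assumes T: "bounded_linear T"
    and H: "continuous_on UNIV H" "\<And>y. norm (H y) \<le> A"
    and G: "continuous_on UNIV (\<lambda>(s, y). G s y)" "\<And>s y. norm (G s y) \<le> C"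
    and t: "0 \<le> t"
  shows "T (\<integral>w. duhamel_integrand H G t x w \<partial>duhamel_measure)
       = (\<integral>w. duhamel_integrand (\<lambda>y. T (H y)) (\<lambda>s y. T (G s y)) t x w \<partial>duhamel_measure)"
proof -
  interpret bounded_linear T by fact
  have "integrable duhamel_measure (duhamel_integrand H G t x)"
    by (intro integrable_duhamel_measure[where B="A + t * C"] norm_duhamel_integrand_le H G t
        continuous_on_duhamel_integrand continuous_intros)
  then show ?thesis
    by (subst integral_bounded_linear[OF T, symmetric]) (auto simp: duhamel_integrand_def[abs_def] add scaleR)
qed

text \<open>
  The fixed point lives in the ball of radius \<open>R = M + 2\<close>: the choice of \<open>\<delta>\<close> below keeps the weighted triple
  of the datum within \<open>M + 1\<close>, and the iteration may add another \<open>1\<close>. The time \<open>\<tau>\<close> is fixed from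
  \<open>R\<close> and the bounds of \<open>f\<close> before \<open>h\<close> is chosen.
\<close>

theorem local_existence:
  assumes f: "C2_bounded f" and M: "0 \<le> M"
  obtains \<tau> where "0 < \<tau>"
    "\<And>h. C2_bounded h \<Longrightarrow> (\<And>x. \<bar>h x\<bar> \<le> M) \<Longrightarrow> \<exists>u. strip_solution f \<tau> u \<and> u 0 = h"
proof -
  obtain K where K: "\<And>y. \<bar>f y\<bar> \<le> K" "\<And>y. \<bar>deriv f y\<bar> \<le> K" "\<And>y. \<bar>deriv (deriv f) y\<bar> \<le> K"
    using f unfolding C2_bounded_def by blast
  have f': "\<And>x. (f has_real_derivative deriv f x) (at x)"
    "\<And>x. (deriv f has_real_derivative deriv (deriv f) x) (at x)"
    using f unfolding C2_bounded_def by blast+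
  have K0: "0 \<le> K" using K(1)[of 0] by linarith
  define R where "R = M + 2"
  define L where "L = 14 * (K + R)"
  have R: "2 \<le> R" and L: "28 \<le> L" using M K0 by (auto simp: R_def L_def)
  define \<tau> where "\<tau> = 1 / (2 * L * R)"
  have \<tau>: "0 < \<tau>" "\<tau> * (L * R) \<le> 1 / 2" using R L by (auto simp: \<tau>_def)
  show ?thesis
  proof (rule that[OF \<tau>(1)])
    fix h :: "real \<Rightarrow> real" assume h: "C2_bounded h" and hM: "\<And>x. \<bar>h x\<bar> \<le> M"
    obtain Kh where Kh: "\<And>y. \<bar>h y\<bar> \<le> Kh" "\<And>y. \<bar>deriv h y\<bar> \<le> Kh" "\<And>y. \<bar>deriv (deriv h) y\<bar> \<le> Kh"
      using h unfolding C2_bounded_def by blast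
    have h': "\<And>x. (h has_real_derivative deriv h x) (at x)"
      "\<And>x. (deriv h has_real_derivative deriv (deriv h) x) (at x)"
      and ch2: "continuous_on UNIV (deriv (deriv h))"
      using h unfolding C2_bounded_def by blast+
    have ch: "continuous_on UNIV h" and ch1: "continuous_on UNIV (deriv h)"
      using h' by (auto intro!: DERIV_continuous_on[of _ _ "deriv _"] intro: has_field_derivative_at_within)
    have Kh0: "0 \<le> Kh" using Kh(1)[of 0] by linarith
    \<comment> \<open>This makes \<open>\<delta> Kh \<le> 1 / 2\<close>, so the two weighted derivatives add at most \<open>1\<close> to \<open>sup |h|\<close>.\<close>
    define \<delta> where "\<delta> = 1 / (2 * Kh + 1)"
    have \<delta>: "0 < \<delta>" "\<delta> \<le> 1" "\<delta> * Kh \<le> 1 / 2" using Kh0 by (auto simp: \<delta>_def field_simps)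
    define H where "H y = (h y, \<delta> * deriv h y, \<delta>\<^sup>2 * deriv (deriv h) y)" for y
    let ?Q = "reaction_jet f \<delta>"
    have Hb: "norm (H y) \<le> M + 1" for y
    proof -
      have "norm (H y) \<le> \<bar>h y\<bar> + (\<bar>\<delta> * deriv h y\<bar> + \<bar>\<delta>\<^sup>2 * deriv (deriv h) y\<bar>)"
        unfolding H_def using norm_Pair_le[of "h y" "(\<delta> * deriv h y, \<delta>\<^sup>2 * deriv (deriv h) y)"]
          norm_Pair_le[of "\<delta> * deriv h y" "\<delta>\<^sup>2 * deriv (deriv h) y"] by simp
      moreover have "\<bar>\<delta> * deriv h y\<bar> \<le> \<delta> * Kh"
        using Kh \<delta> by (simp add: abs_mult mult_left_mono)
      moreover have "\<bar>\<delta>\<^sup>2 * deriv (deriv h) y\<bar> \<le> \<delta> * Kh"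
      proof -
        have "\<delta>\<^sup>2 \<le> \<delta>" using \<delta> by (simp add: power2_eq_square mult_left_le)
        then show ?thesis using Kh \<delta> by (simp add: abs_mult mult_mono)
      qed
      ultimately show ?thesis using hM[of y] \<delta> by linarith
    qed
    have cH: "continuous_on UNIV H"
      unfolding H_def by (intro continuous_intros ch ch1 ch2)
    define P1 P2 P3 :: "real \<times> real \<times> real \<Rightarrow> real"
      where P_defs: "P1 = (\<lambda>e. fst e)" "P2 = (\<lambda>e. fst (snd e) / \<delta>)" "P3 = (\<lambda>e. snd (snd e) / \<delta>\<^sup>2)"
    have bl: "bounded_linear P1" "bounded_linear P2" "bounded_linear P3"
      unfolding P_defs
      by (rule bounded_linear_fst bounded_linear_compose[OF bounded_linear_divide bounded_linear_compose[OF bounded_linear_fst bounded_linear_snd]]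
          bounded_linear_compose[OF bounded_linear_divide bounded_linear_compose[OF bounded_linear_snd bounded_linear_snd]])+
    define D where "D = {U :: (real \<times> real) \<Rightarrow>\<^sub>C (real \<times> real \<times> real).
        \<forall>t x. ((\<lambda>y. P1 (U (t, y))) has_real_derivative P2 (U (t, x))) (at x)} \<inter>
      {U :: (real \<times> real) \<Rightarrow>\<^sub>C (real \<times> real \<times> real). \<forall>t x. ((\<lambda>y. P2 (U (t, y))) has_real_derivative P3 (U (t, x))) (at x)}"
    define B where "B = Kh + L * R + (L * R) / \<delta> + (L * R) / \<delta>\<^sup>2"
    have nonneg: "0 \<le> L * R" "0 \<le> (L * R) / \<delta>" "0 \<le> (L * R) / \<delta>\<^sup>2" using L R \<delta> by auto
    have cQ: "continuous_on UNIV (\<lambda>(s, y). ?Q y (apply_bcontfun U (s, y)))" for U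
      unfolding case_prod_beta
      by (intro continuous_on_compose_pair[OF continuous_on_reaction_jet[OF f]] continuous_intros
          continuous_on_compose2[OF continuous_on_apply_bcontfun[of UNIV U]]) auto
    have Q0: "?Q y 0 = 0" for y by (simp add: zero_prod_def)
    have lip: "norm (?Q y a - ?Q y b) \<le> L * norm (a - b)" if "norm a \<le> R" "norm b \<le> R" for y a b
      unfolding L_def using reaction_jet_lipschitz[of f K \<delta> a R b y] K \<delta> that by simp
    have Qb: "norm (?Q y a) \<le> L * R" if "norm a \<le> R" for y a
    proof -
      have "norm (?Q y a) \<le> L * norm a" using lip[of a 0 y] that R Q0 by simp
      also have "\<dots> \<le> L * R" using that L by (intro mult_left_mono) auto
      finally show ?thesis .
    qed
    define G1 where "G1 U s y = P1 (?Q y (apply_bcontfun U (s, y)))" for U :: "(real \<times> real) \<Rightarrow>\<^sub>C (real \<times> real \<times> real)" and s y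
    define G2 where "G2 U s y = P2 (?Q y (apply_bcontfun U (s, y)))" for U :: "(real \<times> real) \<Rightarrow>\<^sub>C (real \<times> real \<times> real)" and s y
    define G3 where "G3 U s y = P3 (?Q y (apply_bcontfun U (s, y)))" for U :: "(real \<times> real) \<Rightarrow>\<^sub>C (real \<times> real \<times> real)" and s y
    have Gc: "continuous_on UNIV (\<lambda>(s, y). G1 U s y)" "continuous_on UNIV (\<lambda>(s, y). G2 U s y)"
        "continuous_on UNIV (\<lambda>(s, y). G3 U s y)" for U
      using bounded_linear.continuous_on[OF bl(1) cQ[of U]] bounded_linear.continuous_on[OF bl(2) cQ[of U]]
        bounded_linear.continuous_on[OF bl(3) cQ[of U]]
      by (auto simp: G1_def G2_def G3_def case_prod_beta)
    have Gb: "\<bar>G1 U s y\<bar> \<le> B" "\<bar>G2 U s y\<bar> \<le> B" "\<bar>G3 U s y\<bar> \<le> B" if U: "norm U \<le> R" for U s y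
    proof -
      obtain a b c where e: "?Q y (apply_bcontfun U (s, y)) = (a, b, c)" by (cases "?Q y (apply_bcontfun U (s, y))") auto
      have n: "norm (a, b, c) \<le> L * R" using Qb[of "U (s, y)" y] norm_bounded[of U "(s, y)"] U e by simp
      have "\<bar>a\<bar> \<le> L * R" "\<bar>b\<bar> \<le> L * R" "\<bar>c\<bar> \<le> L * R"
        using n norm_fst_le[of a "(b, c)"] norm_snd_le[of "(b, c)" a] norm_fst_le[of b c] norm_snd_le[of c b] by auto
      then have "\<bar>a\<bar> \<le> L * R" "\<bar>b / \<delta>\<bar> \<le> L * R / \<delta>" "\<bar>c / \<delta>\<^sup>2\<bar> \<le> L * R / \<delta>\<^sup>2"
        using divide_right_mono[of "\<bar>b\<bar>" "L * R" \<delta>] divide_right_mono[of "\<bar>c\<bar>" "L * R" "\<delta>\<^sup>2"] \<delta>(1)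
        by (simp_all add: abs_divide)
      then show "\<bar>G1 U s y\<bar> \<le> B" "\<bar>G2 U s y\<bar> \<le> B" "\<bar>G3 U s y\<bar> \<le> B"
        using nonneg Kh0 unfolding G1_def G2_def G3_def P_defs e B_def fst_conv snd_conv by linarith+
    qed
    have KhB: "Kh \<le> B" using nonneg by (simp add: B_def)
    note hB = Kh(1)[THEN order_trans, OF KhB] Kh(2)[THEN order_trans, OF KhB] Kh(3)[THEN order_trans, OF KhB]
    have Gd: "(G1 U s has_real_derivative G2 U s y) (at y)" "(G2 U s has_real_derivative G3 U s y) (at y)"
      if "U \<in> D" for U s y
    proof -
      have d1: "((\<lambda>y. P1 (U (s, y))) has_real_derivative P2 (U (s, y))) (at y)"
        and d2: "((\<lambda>y. P2 (U (s, y))) has_real_derivative P3 (U (s, y))) (at y)" for y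
        using that by (auto simp: D_def)
      have jet: "?Q y e = (- 2 * f y * P1 e - (P1 e)\<^sup>2,
          \<delta> * (- 2 * deriv f y * P1 e - 2 * f y * P2 e - 2 * P1 e * P2 e),
          \<delta>\<^sup>2 * (- 2 * deriv (deriv f) y * P1 e - 4 * deriv f y * P2 e - 2 * f y * P3 e - 2 * (P2 e)\<^sup>2 - 2 * P1 e * P3 e))" for y e
        using \<delta> by (cases e) (auto simp: P_defs field_simps power2_eq_square)
      have G1e: "G1 U s = (\<lambda>y. - 2 * f y * P1 (U (s, y)) - (P1 (U (s, y)))\<^sup>2)"
        by (rule ext) (simp add: G1_def jet P_defs(1)[THEN fun_cong, of "(_, _)"])
      have G2e: "G2 U s = (\<lambda>y. - 2 * deriv f y * P1 (U (s, y)) - 2 * f y * P2 (U (s, y)) - 2 * P1 (U (s, y)) * P2 (U (s, y)))"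
        using \<delta> by (intro ext) (simp add: G2_def jet P_defs(2)[THEN fun_cong, of "(_, _)"])
      have G3e: "G3 U s = (\<lambda>y. - 2 * deriv (deriv f) y * P1 (U (s, y)) - 4 * deriv f y * P2 (U (s, y))
          - 2 * f y * P3 (U (s, y)) - 2 * (P2 (U (s, y)))\<^sup>2 - 2 * P1 (U (s, y)) * P3 (U (s, y)))"
        using \<delta> by (intro ext) (simp add: G3_def jet P_defs(3)[THEN fun_cong, of "(_, _)"])
      show "(G1 U s has_real_derivative G2 U s y) (at y)"
        unfolding G1e G2e
        by (rule derivative_eq_intros d1 d2 f' refl | simp add: algebra_simps)+
      show "(G2 U s has_real_derivative G3 U s y) (at y)"
        unfolding G2e G3e
        by (rule derivative_eq_intros d1 d2 f' refl | simp add: algebra_simps power2_eq_square)+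
    qed
    let ?c = "\<lambda>t. max 0 (min \<tau> t)"
    have comps: "P1 (mild_map \<tau> H ?Q U (t, x)) = (\<integral>w. duhamel_integrand h (G1 U) (?c t) x w \<partial>duhamel_measure)"
      "P2 (mild_map \<tau> H ?Q U (t, x)) = (\<integral>w. duhamel_integrand (deriv h) (G2 U) (?c t) x w \<partial>duhamel_measure)"
      "P3 (mild_map \<tau> H ?Q U (t, x)) = (\<integral>w. duhamel_integrand (deriv (deriv h)) (G3 U) (?c t) x w \<partial>duhamel_measure)"
      if U: "norm U \<le> R" for U :: "(real \<times> real) \<Rightarrow>\<^sub>C (real \<times> real \<times> real)" and t x
    proof -
      have b: "norm (?Q y (U (s, y))) \<le> L * R" for s y
        using norm_bounded[of U "(s, y)"] U by (intro Qb) simp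
      have e: "P1 (H y) = h y" "P2 (H y) = deriv h y" "P3 (H y) = deriv (deriv h) y" for y
        using \<delta> by (auto simp: P_defs H_def)
      show "P1 (mild_map \<tau> H ?Q U (t, x)) = (\<integral>w. duhamel_integrand h (G1 U) (?c t) x w \<partial>duhamel_measure)"
        "P2 (mild_map \<tau> H ?Q U (t, x)) = (\<integral>w. duhamel_integrand (deriv h) (G2 U) (?c t) x w \<partial>duhamel_measure)"
        "P3 (mild_map \<tau> H ?Q U (t, x)) = (\<integral>w. duhamel_integrand (deriv (deriv h)) (G3 U) (?c t) x w \<partial>duhamel_measure)"
        using bounded_linear_duhamel_integral[OF bl(1) cH Hb cQ[of U] b]
          bounded_linear_duhamel_integral[OF bl(2) cH Hb cQ[of U] b]
          bounded_linear_duhamel_integral[OF bl(3) cH Hb cQ[of U] b]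
        by (simp_all add: mild_map_def e G1_def[abs_def] G2_def[abs_def] G3_def[abs_def])
    qed
    obtain U where U: "U \<in> D" "norm U \<le> M + 1 + 1" "\<And>p. apply_bcontfun U p = mild_map \<tau> H ?Q (apply_bcontfun U) p"
    proof (rule mild_solution_exists[of H "M + 1" ?Q L \<tau> D, OF cH Hb continuous_on_reaction_jet[OF f] Q0])
      show "closed D" unfolding D_def by (intro closed_Int closed_derivative_relation bl)
      show "0 \<in> D"
        using bl[THEN linear_simps(3)] by (simp add: D_def)
      show "V \<in> D" if W: "W \<in> D" "norm W \<le> M + 1 + 1"
        and V: "\<And>p. apply_bcontfun V p = mild_map \<tau> H ?Q (apply_bcontfun W) p" for V W
      proof -
        have n: "norm W \<le> R" using W by (simp add: R_def)
        show ?thesis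
          unfolding D_def using comps[OF n]
            integral_duhamel_integrand_has_derivative[OF h'(1) ch1 hB(1,2) Gd(1)[OF W(1)] Gc(1) Gc(2) Gb(1)[OF n] Gb(2)[OF n]]
            integral_duhamel_integrand_has_derivative[OF h'(2) ch2 hB(2,3) Gd(2)[OF W(1)] Gc(2) Gc(3) Gb(2)[OF n] Gb(3)[OF n]]
          by (auto simp: V)
      qed
    qed (use lip \<tau> L in \<open>auto simp: R_def add.assoc\<close>)
    then have n: "norm U \<le> R" by (simp add: R_def)
    define u where "u t x = P1 (U (t, x))" for t x
    have du: "(u t has_real_derivative P2 (U (t, x))) (at x)" for t x
      using U(1) by (auto simp: D_def u_def[abs_def])
    have ddu: "((\<lambda>x. P2 (U (t, x))) has_real_derivative P3 (U (t, x))) (at x)" for t x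
      using U(1) by (auto simp: D_def)
    have e1: "deriv (u t) = (\<lambda>x. P2 (U (t, x)))" for t using du by (intro ext DERIV_imp_deriv)
    have e2: "deriv (\<lambda>x. P2 (U (t, x))) = (\<lambda>x. P3 (U (t, x)))" for t using ddu by (intro ext DERIV_imp_deriv)
    have cU: "continuous_on S (\<lambda>z. p (U z))" if "bounded_linear p" for p :: "real \<times> real \<times> real \<Rightarrow> real" and S
      by (intro bounded_linear.continuous_on[OF that] continuous_on_apply_bcontfun)
    have cUx: "continuous_on UNIV (\<lambda>y. p (U (t, y)))" if "bounded_linear p" for p :: "real \<times> real \<times> real \<Rightarrow> real" and t
      by (intro continuous_on_compose2[OF cU[OF that, of UNIV]] continuous_intros) auto
    have bU: "\<exists>B. \<forall>z. \<bar>p (U z)\<bar> \<le> B" if p: "bounded_linear p" for p :: "real \<times> real \<times> real \<Rightarrow> real"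
    proof -
      obtain k where k: "0 < k" "\<And>v. norm (p v) \<le> norm v * k" using bounded_linear.pos_bounded[OF p] by blast
      have "\<bar>p (U z)\<bar> \<le> R * k" for z
        using k(2)[of "U z"] order_trans[OF norm_bounded[of U z] n] k(1)
        by (smt (verit) mult_right_mono real_norm_def)
      then show ?thesis by blast
    qed
    obtain B1 B2 B3 where Bs: "\<And>z. \<bar>P1 (U z)\<bar> \<le> B1" "\<And>z. \<bar>P2 (U z)\<bar> \<le> B2" "\<And>z. \<bar>P3 (U z)\<bar> \<le> B3"
      using bU[OF bl(1)] bU[OF bl(2)] bU[OF bl(3)] by blast
    have duh: "u t x = duhamel t h (G1 U) x" "P3 (U (t, x)) = duhamel t (deriv (deriv h)) (G3 U) x"
      if "t \<in> {0..\<tau>}" for t x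
      using that comps(1)[OF n, of t x] comps(3)[OF n, of t x] U(3)[of "(t, x)"]
        integral_duhamel_integrand[OF ch hB(1) Gc(1) Gb(1)[OF n], of t x]
        integral_duhamel_integrand[OF ch2 hB(3) Gc(3) Gb(3)[OF n], of t x]
      by (simp_all add: u_def)
    have "strip_solution f \<tau> u"
      unfolding strip_solution_def
    proof (intro conjI ballI allI)
      show "continuous_on ({0..<\<tau>} \<times> UNIV) (\<lambda>(t, x). u t x)"
        "continuous_on ({0..<\<tau>} \<times> UNIV) (\<lambda>(t, x). deriv (u t) x)"
        "continuous_on ({0..<\<tau>} \<times> UNIV) (\<lambda>(t, x). deriv (deriv (u t)) x)"
        unfolding e1 e2 u_def using cU[OF bl(1)] cU[OF bl(2)] cU[OF bl(3)] by (auto simp: case_prod_beta)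
      show "C2_bounded (u t)" for t
        unfolding C2_bounded_def e1 e2
      proof (intro conjI allI)
        show "\<exists>B. \<forall>x. \<bar>u t x\<bar> \<le> B \<and> \<bar>P2 (U (t, x))\<bar> \<le> B \<and> \<bar>P3 (U (t, x))\<bar> \<le> B"
          using Bs by (intro exI[of _ "max B1 (max B2 B3)"]) (simp add: u_def le_max_iff_disj)
      qed (use du ddu cUx[OF bl(3)] in auto)
      show "\<exists>B. \<forall>t\<in>{0..s}. \<forall>x. \<bar>u t x\<bar> \<le> B" for s using Bs(1) by (auto simp: u_def)
      fix t x assume t: "t \<in> {0<..<\<tau>}"
      have "continuous_on {0..\<tau>} (\<lambda>r. P3 (U (r, x)))"
        by (intro continuous_on_compose2[OF cU[OF bl(3), of UNIV]] continuous_intros) auto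
      then have c: "continuous_on {0..\<tau>} (\<lambda>r. duhamel r (deriv (deriv h)) (G3 U) x)"
        by (rule continuous_on_eq) (rule duh(2))
      have "((\<lambda>s. duhamel s h (G1 U) x) has_real_derivative duhamel t (deriv (deriv h)) (G3 U) x + G1 U t x) (at t)"
        using t by (intro duhamel_has_time_derivative[OF h' ch2 hB Gd[OF U(1)] Gc(1) Gc(3) Gb[OF n] c]) auto
      moreover have "duhamel t (deriv (deriv h)) (G3 U) x + G1 U t x = P3 (U (t, x)) - 2 * f x * u t x - (u t x)\<^sup>2"
        using duh(2)[of t x] t by (cases "U (t, x)") (simp add: G1_def P_defs u_def)
      ultimately have d: "((\<lambda>s. duhamel s h (G1 U) x) has_real_derivative P3 (U (t, x)) - 2 * f x * u t x - (u t x)\<^sup>2) (at t)"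
        by simp
      have "eventually (\<lambda>s. s \<in> {0<..<\<tau>}) (nhds t)" using t by (intro eventually_nhds_in_open) auto
      then have "\<forall>\<^sub>F s in nhds t. u s x = duhamel s h (G1 U) x"
        by eventually_elim (use duh(1) in auto)
      then show "((\<lambda>s. u s x) has_real_derivative deriv (deriv (u t)) x - 2 * f x * u t x - (u t x)\<^sup>2) (at t)"
        unfolding e1 e2 using d by (subst DERIV_cong_ev[OF refl _ refl]) auto
    qed
    moreover have "u 0 = h"
      using duh(1)[of 0] \<tau> set_integral_point[of 0]
      by (auto simp: duhamel_def fun_eq_iff)
    ultimately show "\<exists>u. strip_solution f \<tau> u \<and> u 0 = h" by blast
  qed
qed

section \<open>Maximum principle and uniqueness\<close>

lemma second_derivative_nonpos_at_max:
  fixes g g' :: "real \<Rightarrow> real"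
  assumes g: "\<And>y. (g has_real_derivative g' y) (at y)" and g': "(g' has_real_derivative l) (at x)"
    and e: "0 < e" and max: "\<And>y. \<bar>y - x\<bar> < e \<Longrightarrow> g y \<le> g x"
  shows "l \<le> 0"
proof (rule ccontr)
  assume "\<not> l \<le> 0"
  then obtain d where d: "0 < d" "\<And>h. 0 < h \<Longrightarrow> h < d \<Longrightarrow> g' x < g' (x + h)"
    using DERIV_pos_inc_right[OF g'] by auto
  have "g' x = 0"
    using DERIV_local_max[OF g e] max by (auto simp: abs_minus_commute)
  define h where "h = min d e / 2"
  have h: "0 < h" "h < d" "h < e" using d e by (auto simp: h_def min_def)
  obtain z where z: "x < z" "z < x + h" "g (x + h) - g x = (x + h - x) * g' z"
    using MVT2[of x "x + h" g g'] h g by auto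
  have "0 < g' z" using d(2)[of "z - x"] z h \<open>g' x = 0\<close> by simp
  then have "g x < g (x + h)" using z h by (simp add: algebra_simps)
  with max[of "x + h"] h show False by auto
qed

text \<open>
  If \<open>d\<close> is positive at \<open>(t, x)\<close>, then so is \<open>exp (- \<Lambda> s) d(s, y) - \<eta> (1 + y^2 + 3 s)\<close> for a small
  \<open>\<eta>\<close>. As \<open>d\<close> is bounded above, the quadratic term forces this function to attain its maximum over the strip. There
  the time derivative is nonnegative and the second space derivative nonpositive, but the differential
  inequality makes the former at most the latter plus \<open>2 \<eta> - 3 \<eta>\<close>.
\<close>

theorem maximum_principle:
  fixes d :: "real \<Rightarrow> real \<Rightarrow> real"
  assumes cont: "continuous_on ({0..\<tau>} \<times> UNIV) (\<lambda>(t, x). d t x)"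
    and bnd: "\<And>t x. t \<in> {0..\<tau>} \<Longrightarrow> d t x \<le> B"
    and dx: "\<And>t x. t \<in> {0<..\<tau>} \<Longrightarrow> (d t has_real_derivative dx t x) (at x)"
    and dxx: "\<And>t x. t \<in> {0<..\<tau>} \<Longrightarrow> (dx t has_real_derivative dxx t x) (at x)"
    and dt: "\<And>t x. t \<in> {0<..\<tau>} \<Longrightarrow> ((\<lambda>s. d s x) has_real_derivative dt t x) (at t)"
    and ineq: "\<And>t x. t \<in> {0<..\<tau>} \<Longrightarrow> 0 < d t x \<Longrightarrow> dt t x \<le> dxx t x + \<Lambda> * d t x"
    and init: "\<And>x. d 0 x \<le> 0"
    and t: "t \<in> {0..\<tau>}"
  shows "d t x \<le> 0"
proof (rule ccontr)
  assume "\<not> d t x \<le> 0"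
  then have pos: "0 < d t x" by simp
  define \<eta> where "\<eta> = exp (- \<Lambda> * t) * d t x / (2 * (1 + x\<^sup>2 + 3 * t))"
  have den: "0 < 1 + x\<^sup>2 + 3 * t" using t zero_le_power2[of x] by (simp add: add_pos_nonneg)
  have \<eta>: "0 < \<eta>" using pos den by (simp add: \<eta>_def)
  define z where "z s y = exp (- \<Lambda> * s) * d s y - \<eta> * (1 + y\<^sup>2 + 3 * s)" for s y
  have z1: "0 < z t x"
  proof -
    have half: "N / (2 * D) * D = N / 2" if "0 < D" for N D :: real using that by simp
    have "\<eta> * (1 + x\<^sup>2 + 3 * t) = exp (- \<Lambda> * t) * d t x / 2" unfolding \<eta>_def by (rule half[OF den])
    moreover have "0 < exp (- \<Lambda> * t) * d t x" using pos by simp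
    ultimately show ?thesis unfolding z_def by linarith
  qed
  define C where "C = exp (\<bar>\<Lambda>\<bar> * \<tau>) * \<bar>B\<bar>"
  have C: "0 \<le> C" by (simp add: C_def)
  have eb: "exp (- \<Lambda> * s) * d s y \<le> C" if "s \<in> {0..\<tau>}" for s y
  proof -
    have "- \<Lambda> * s \<le> \<bar>\<Lambda>\<bar> * \<tau>"
    proof -
      have "- \<Lambda> * s \<le> \<bar>\<Lambda>\<bar> * s" using that by (intro mult_right_mono) auto
      also have "\<dots> \<le> \<bar>\<Lambda>\<bar> * \<tau>" using that by (intro mult_left_mono) auto
      finally show ?thesis .
    qed
    then have "exp (- \<Lambda> * s) * \<bar>B\<bar> \<le> C" unfolding C_def by (intro mult_right_mono) auto
    moreover have "exp (- \<Lambda> * s) * d s y \<le> exp (- \<Lambda> * s) * \<bar>B\<bar>"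
      using bnd[OF that, of y] by (intro mult_left_mono) auto
    ultimately show ?thesis by linarith
  qed
  \<comment> \<open>Beyond \<open>X\<close> the quadratic penalty exceeds the bound \<open>C\<close>, since \<open>X^2 \<ge> X\<close>.\<close>
  define X where "X = 1 + C / \<eta> + \<bar>x\<bar>"
  have X: "1 \<le> X" "\<bar>x\<bar> \<le> X" "C \<le> \<eta> * X"
    using C \<eta> by (auto simp: X_def field_simps)
  have "compact ({0..\<tau>} \<times> {-X..X})" by (intro compact_Times) auto
  moreover have "(t, x) \<in> {0..\<tau>} \<times> {-X..X}" using t X by auto
  moreover have "continuous_on ({0..\<tau>} \<times> {-X..X}) (\<lambda>p. z (fst p) (snd p))"
    unfolding z_def using continuous_on_subset[OF cont, of "{0..\<tau>} \<times> {-X..X}"]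
    by (auto intro!: continuous_intros simp: case_prod_beta)
  ultimately obtain p where p: "p \<in> {0..\<tau>} \<times> {-X..X}"
      "\<And>q. q \<in> {0..\<tau>} \<times> {-X..X} \<Longrightarrow> z (fst q) (snd q) \<le> z (fst p) (snd p)"
    using continuous_attains_sup[of "{0..\<tau>} \<times> {-X..X}" "\<lambda>p. z (fst p) (snd p)"] by blast
  define a b where "a = fst p" and "b = snd p"
  have ab: "a \<in> {0..\<tau>}" "b \<in> {-X..X}" using p(1) by (auto simp: a_def b_def)
  have max: "z s y \<le> z a b" if "s \<in> {0..\<tau>}" "y \<in> {-X..X}" for s y
    using p(2)[of "(s, y)"] that by (auto simp: a_def b_def)
  have zpos: "0 < z a b" using max[OF t, of x] z1 X(2) by (simp add: abs_le_iff)
  have dpos: "0 < d a b"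
  proof -
    have "0 < exp (- \<Lambda> * a) * d a b"
      using zpos \<eta> ab by (simp add: z_def) (smt (verit) mult_nonneg_nonneg zero_le_power2)
    then show ?thesis by (simp add: zero_less_mult_iff)
  qed
  have a0: "a \<noteq> 0" using dpos init[of b] by auto
  then have a: "a \<in> {0<..\<tau>}" using ab by auto
  have bX: "\<bar>b\<bar> < X"
  proof (rule ccontr)
    assume "\<not> \<bar>b\<bar> < X"
    then have "X * 1 \<le> \<bar>b\<bar> * \<bar>b\<bar>" using X by (intro mult_mono) auto
    then have "\<eta> * X \<le> \<eta> * b\<^sup>2" using \<eta> by (simp add: power2_eq_square)
    then have "z a b \<le> C - \<eta> * X - \<eta> * (1 + 3 * a)"
      using eb[OF ab(1), of b] by (simp add: z_def algebra_simps)
    moreover have "0 \<le> \<eta> * (1 + 3 * a)" using \<eta> ab by simp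
    ultimately show False using zpos X by linarith
  qed
  define E where "E = exp (- \<Lambda> * a)"
  have E: "0 < E" by (simp add: E_def)
  have "E * dxx a b - \<eta> * 2 \<le> 0"
  proof (rule second_derivative_nonpos_at_max)
    show "(z a has_real_derivative E * dx a y - \<eta> * (2 * y)) (at y)" for y
      unfolding z_def E_def using dx[OF a, of y]
      by (auto intro!: derivative_eq_intros)
    show "((\<lambda>y. E * dx a y - \<eta> * (2 * y)) has_real_derivative E * dxx a b - \<eta> * 2) (at b)"
      using dxx[OF a, of b] by (auto intro!: derivative_eq_intros)
    show "0 < X - \<bar>b\<bar>" using bX by simp
    show "z a y \<le> z a b" if "\<bar>y - b\<bar> < X - \<bar>b\<bar>" for y
      using that by (intro max ab) auto
  qed
  moreover have "0 \<le> E * (dt a b - \<Lambda> * d a b) - 3 * \<eta>"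
  proof (rule ccontr)
    assume neg: "\<not> 0 \<le> E * (dt a b - \<Lambda> * d a b) - 3 * \<eta>"
    have "((\<lambda>s. z s b) has_real_derivative E * (dt a b - \<Lambda> * d a b) - 3 * \<eta>) (at a)"
      unfolding z_def E_def using dt[OF a, of b]
      by (auto intro!: derivative_eq_intros simp: algebra_simps)
    from DERIV_neg_dec_left[OF this] neg
    obtain e where e: "0 < e" "\<And>h. 0 < h \<Longrightarrow> h < e \<Longrightarrow> z a b < z (a - h) b"
      by (auto simp: not_le)
    define h where "h = min e a / 2"
    have "0 < h" "h < e" "h \<le> a" using e a by (auto simp: h_def min_def)
    then show False using e(2)[of h] max[of "a - h" b] ab by auto
  qed
  moreover have "E * (dt a b - \<Lambda> * d a b) \<le> E * dxx a b"
    using ineq[OF a dpos] E by (intro mult_left_mono) auto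
  ultimately show False using \<eta> by linarith
qed

lemma continuous_on_slice:
  fixes v :: "real \<Rightarrow> real \<Rightarrow> real"
  assumes "continuous_on (S \<times> UNIV) (\<lambda>(t, x). v t x)" "t \<in> S"
  shows "continuous_on UNIV (v t)"
proof -
  have "continuous_on UNIV (\<lambda>x. case (t, x) of (t, x) \<Rightarrow> v t x)"
    using assms(2) by (intro continuous_on_compose2[OF assms(1)] continuous_intros) auto
  then show ?thesis by simp
qed

text \<open>
  What the maximum principle needs, and what both \<open>strip_solution\<close> and the classical solutions
  that are locally bounded in time provide.
\<close>

definition bounded_solution :: "(real \<Rightarrow> real) \<Rightarrow> real \<Rightarrow> (real \<Rightarrow> real \<Rightarrow> real) \<Rightarrow> bool" where
  "bounded_solution f T u \<longleftrightarrow>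
     continuous_on ({0..<T} \<times> UNIV) (\<lambda>(t, x). u t x) \<and>
     (\<forall>t\<in>{0<..<T}. \<forall>x.
        (u t has_real_derivative deriv (u t) x) (at x) \<and>
        (deriv (u t) has_real_derivative deriv (deriv (u t)) x) (at x) \<and>
        ((\<lambda>s. u s x) has_real_derivative deriv (deriv (u t)) x - 2 * f x * u t x - (u t x)\<^sup>2) (at t)) \<and>
     (\<forall>\<tau>\<in>{0..<T}. \<exists>B. \<forall>t\<in>{0..\<tau>}. \<forall>x. \<bar>u t x\<bar> \<le> B)"

lemma bounded_solution_mono: "bounded_solution f T u \<Longrightarrow> S \<le> T \<Longrightarrow> bounded_solution f S u"
  unfolding bounded_solution_def
  by (auto intro: continuous_on_subset)

lemma strip_imp_bounded_solution: "strip_solution f T u \<Longrightarrow> bounded_solution f T u"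
  unfolding strip_solution_def bounded_solution_def C2_bounded_def by auto

text \<open>
  The difference \<open>d = u - v\<close> satisfies \<open>d_t = d_xx - 2 f d - (u + v) d\<close>, and \<open>- (u + v)\<close> is bounded on
  every shorter strip. Where \<open>d\<close> is positive, the term with \<open>f\<close> only helps.
\<close>

lemma bounded_solution_le:
  assumes u: "bounded_solution f T u" and v: "bounded_solution f T v"
    and f: "\<And>x. 0 \<le> f x" and init: "\<And>x. u 0 x \<le> v 0 x" and t: "t \<in> {0..<T}"
  shows "u t x \<le> v t x"
proof -
  obtain A B where b: "\<And>s y. s \<in> {0..t} \<Longrightarrow> \<bar>u s y\<bar> \<le> A" "\<And>s y. s \<in> {0..t} \<Longrightarrow> \<bar>v s y\<bar> \<le> B"
    using u v t unfolding bounded_solution_def by meson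
  have sub: "{0..t} \<times> UNIV \<subseteq> {0..<T} \<times> (UNIV :: real set)" using t by auto
  have "u t x - v t x \<le> 0"
  proof (rule maximum_principle[where d="\<lambda>t x. u t x - v t x" and \<tau>=t and B="A+B" and \<Lambda>="A+B"
        and dx="\<lambda>t x. deriv (u t) x - deriv (v t) x"
        and dxx="\<lambda>t x. deriv (deriv (u t)) x - deriv (deriv (v t)) x"
        and dt="\<lambda>t x. (deriv (deriv (u t)) x - 2 * f x * u t x - (u t x)\<^sup>2) - (deriv (deriv (v t)) x - 2 * f x * v t x - (v t x)\<^sup>2)"])
    show "continuous_on ({0..t} \<times> UNIV) (\<lambda>(t, x). u t x - v t x)"
      using u v continuous_on_subset[OF _ sub]
      by (auto simp: bounded_solution_def case_prod_beta intro!: continuous_intros)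
    fix s y
    show "u s y - v s y \<le> A + B" if "s \<in> {0..t}" using b[OF that, of y] by linarith
    assume s: "s \<in> {0<..t}"
    then have sT: "s \<in> {0<..<T}" using t by auto
    show "((\<lambda>x. u s x - v s x) has_real_derivative deriv (u s) y - deriv (v s) y) (at y)"
      "((\<lambda>x. deriv (u s) x - deriv (v s) x) has_real_derivative deriv (deriv (u s)) y - deriv (deriv (v s)) y) (at y)"
      "((\<lambda>s. u s y - v s y) has_real_derivative (deriv (deriv (u s)) y - 2 * f y * u s y - (u s y)\<^sup>2)
          - (deriv (deriv (v s)) y - 2 * f y * v s y - (v s y)\<^sup>2)) (at s)"
      using u v sT unfolding bounded_solution_def by (auto intro!: derivative_intros)
    assume pos: "0 < u s y - v s y"
    have "- (u s y + v s y) * (u s y - v s y) \<le> (A + B) * (u s y - v s y)"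
      using b(1)[of s y] b(2)[of s y] s pos by (intro mult_right_mono) auto
    moreover have "0 \<le> 2 * f y * (u s y - v s y)" using f[of y] pos by simp
    ultimately show "(deriv (deriv (u s)) y - 2 * f y * u s y - (u s y)\<^sup>2) - (deriv (deriv (v s)) y - 2 * f y * v s y - (v s y)\<^sup>2)
        \<le> deriv (deriv (u s)) y - deriv (deriv (v s)) y + (A + B) * (u s y - v s y)"
      by (simp add: algebra_simps power2_eq_square)
  qed (use init t in auto)
  then show ?thesis by simp
qed

lemma bounded_solution_unique:
  assumes "bounded_solution f T u" "bounded_solution f T v" "\<And>x. 0 \<le> f x" "u 0 = v 0" "t \<in> {0..<T}"
  shows "u t = v t"
  using bounded_solution_le[OF assms(1,2,3) _ assms(5)] bounded_solution_le[OF assms(2,1,3) _ assms(5)] assms(4)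
  by (auto intro: antisym)

lemma zero_bounded_solution: "bounded_solution f T (\<lambda>_ _. 0)"
  by (auto simp: bounded_solution_def)

section \<open>From pointwise bounds to the norms of the statement\<close>

lemma Linf_norm_le:
  assumes "g \<in> borel_measurable lborel" "\<And>x. \<bar>g x\<bar> \<le> B"
  shows "Lp_norm \<infinity> g \<le> ennreal B"
proof -
  have "esssup lborel (\<lambda>x. ennreal \<bar>g x\<bar>) \<le> ennreal B"
    using assms by (intro esssup_I) (auto intro: ennreal_leI)
  then show ?thesis by (simp add: Lp_norm_def)
qed

text \<open>
  For a continuous function the essential supremum is a supremum, because nonempty open sets
  have positive measure.
\<close>

lemma abs_le_of_Linf_norm_le:
  fixes g :: "real \<Rightarrow> real"
  assumes g: "continuous_on UNIV g" and n: "Lp_norm \<infinity> g \<le> ennreal B" and B: "0 \<le> B"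
  shows "\<bar>g x\<bar> \<le> B"
proof (rule ccontr)
  assume "\<not> \<bar>g x\<bar> \<le> B"
  let ?S = "{x. B < \<bar>g x\<bar>}"
  have S: "open ?S" "?S \<noteq> {}"
    using g \<open>\<not> \<bar>g x\<bar> \<le> B\<close> by (auto intro!: open_Collect_less continuous_intros exI[of _ x])
  have "AE x in lborel. ennreal \<bar>g x\<bar> \<le> esssup lborel (\<lambda>x. ennreal \<bar>g x\<bar>)" by (rule esssup_AE)
  then have "AE x in lborel. \<not> B < \<bar>g x\<bar>"
  proof eventually_elim
    case (elim x)
    then have "ennreal \<bar>g x\<bar> \<le> ennreal B" using n by (simp add: Lp_norm_def)
    then show ?case using B by simp
  qed
  then have "?S \<in> null_sets lborel"
    using S(1) by (subst AE_iff_null_sets) auto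
  then have "negligible ?S"
    unfolding negligible_iff_null_sets by (rule null_sets_completionI)
  then show False using open_not_negligible[OF S] by simp
qed

lemma classical_imp_bounded_solution:
  assumes c: "classical_solution f h T v" and l: "locally_bounded_in_time T v"
  shows "bounded_solution f T v"
  unfolding bounded_solution_def
proof (intro conjI ballI allI)
  show cont: "continuous_on ({0..<T} \<times> UNIV) (\<lambda>(t, x). v t x)" using c by (simp add: classical_solution_def)
  fix t x assume t: "t \<in> {0<..<T}"
  have d: "(\<lambda>s. v s x) field_differentiable (at t)" "v t field_differentiable (at x)"
        "deriv (v t) field_differentiable (at x)"
        "deriv (\<lambda>s. v s x) t = deriv (deriv (v t)) x - 2 * f x * v t x - (v t x)\<^sup>2"
    using c t by (auto simp: classical_solution_def)
  show "(v t has_real_derivative deriv (v t) x) (at x)"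
    "(deriv (v t) has_real_derivative deriv (deriv (v t)) x) (at x)"
    using d(2,3) by (auto simp: field_differentiable_derivI)
  show "((\<lambda>s. v s x) has_real_derivative deriv (deriv (v t)) x - 2 * f x * v t x - (v t x)\<^sup>2) (at t)"
    unfolding d(4)[symmetric] using d(1) by (rule field_differentiable_derivI)
next
  have cont: "continuous_on ({0..<T} \<times> UNIV) (\<lambda>(t, x). v t x)" using c by (simp add: classical_solution_def)
  fix \<tau> assume \<tau>: "\<tau> \<in> {0..<T}"
  then have "(SUP t\<in>{0..\<tau>}. Lp_norm \<infinity> (v t)) < \<infinity>" using l by (simp add: locally_bounded_in_time_def)
  then obtain B where B: "0 \<le> B" "(SUP t\<in>{0..\<tau>}. Lp_norm \<infinity> (v t)) = ennreal B"
    by (metis ennreal_cases less_irrefl infinity_ennreal_def)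
  have "\<bar>v t x\<bar> \<le> B" if "t \<in> {0..\<tau>}" for t x
  proof (rule abs_le_of_Linf_norm_le[where g="v t", OF _ _ B(1)])
    show "continuous_on UNIV (v t)"
      using that \<tau> by (intro continuous_on_slice[OF cont]) auto
    show "Lp_norm \<infinity> (v t) \<le> ennreal B" unfolding B(2)[symmetric] using that by (rule SUP_upper)
  qed
  then show "\<exists>B. \<forall>t\<in>{0..\<tau>}. \<forall>x. \<bar>v t x\<bar> \<le> B" by blast
qed

lemma C2_bounded_continuous: "C2_bounded g \<Longrightarrow> continuous_on UNIV g"
  by (auto simp: C2_bounded_def intro!: DERIV_continuous_on[of _ _ "deriv g"] intro: has_field_derivative_at_within)

lemma strip_imp_classical_solution:
  assumes s: "strip_solution f T u" and f: "continuous_on UNIV f"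
  shows "classical_solution f (u 0) T u" "locally_bounded_in_time T u"
proof -
  have cont: "continuous_on ({0..<T} \<times> UNIV) (\<lambda>(t, x). u t x)"
     "continuous_on ({0..<T} \<times> UNIV) (\<lambda>(t, x). deriv (u t) x)"
     "continuous_on ({0..<T} \<times> UNIV) (\<lambda>(t, x). deriv (deriv (u t)) x)"
    and C2: "\<And>t. t \<in> {0..<T} \<Longrightarrow> C2_bounded (u t)"
    and bnd: "\<And>\<tau>. \<tau> \<in> {0..<T} \<Longrightarrow> \<exists>B. \<forall>t\<in>{0..\<tau>}. \<forall>x. \<bar>u t x\<bar> \<le> B"
    and pde: "\<And>t x. t \<in> {0<..<T} \<Longrightarrow> ((\<lambda>s. u s x) has_real_derivative
        deriv (deriv (u t)) x - 2 * f x * u t x - (u t x)\<^sup>2) (at t)"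
    using s unfolding strip_solution_def by auto
  have meas: "u t \<in> borel_measurable lborel" if "t \<in> {0..<T}" for t
    using borel_measurable_continuous_onI[OF C2_bounded_continuous[OF C2[OF that]]] by simp
  have sub: "{0<..<T} \<times> UNIV \<subseteq> {0..<T} \<times> (UNIV :: real set)" by auto
  note cont' = cont[THEN continuous_on_subset, OF sub]
  have dt: "deriv (\<lambda>s. u s x) t = deriv (deriv (u t)) x - 2 * f x * u t x - (u t x)\<^sup>2" if "t \<in> {0<..<T}" for t x
    using pde[OF that] by (rule DERIV_imp_deriv)
  have "continuous_on ({0<..<T} \<times> UNIV) (\<lambda>p. deriv (deriv (u (fst p))) (snd p) - 2 * f (snd p) * u (fst p) (snd p) - (u (fst p) (snd p))\<^sup>2)"
    using cont' by (intro continuous_intros continuous_on_compose2[OF f]) (auto simp: case_prod_beta)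
  then have ct: "continuous_on ({0<..<T} \<times> UNIV) (\<lambda>(t, x). deriv (\<lambda>s. u s x) t)"
    by (rule continuous_on_eq) (auto simp: dt)
  have Linf: "in_Linf (u t)" if t: "t \<in> {0..<T}" for t
  proof -
    obtain B where "\<forall>x. \<bar>u t x\<bar> \<le> B" using bnd[OF t] t by (metis atLeastAtMost_iff atLeastLessThan_iff order_refl)
    then have "Lp_norm \<infinity> (u t) \<le> ennreal B" by (intro Linf_norm_le meas t) auto
    then show ?thesis using meas[OF t] by (auto simp: in_Linf_def intro: le_less_trans)
  qed
  show "classical_solution f (u 0) T u"
    unfolding classical_solution_def
  proof (intro conjI ballI allI)
    fix t x assume t: "t \<in> {0<..<T}"
    then have "C2_bounded (u t)" by (intro C2) auto
    then show "u t field_differentiable at x" "deriv (u t) field_differentiable at x"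
      unfolding C2_bounded_def field_differentiable_def by blast+
    show "(\<lambda>s. u s x) field_differentiable at t"
      using pde[OF t] field_differentiable_def by blast
  qed (use cont(1) cont' ct dt Linf in auto)
  show "locally_bounded_in_time T u"
    unfolding locally_bounded_in_time_def
  proof
    fix \<tau> assume \<tau>: "\<tau> \<in> {0..<T}"
    obtain B where "\<forall>t\<in>{0..\<tau>}. \<forall>x. \<bar>u t x\<bar> \<le> B" using bnd[OF \<tau>] by auto
    then have "(SUP t\<in>{0..\<tau>}. Lp_norm \<infinity> (u t)) \<le> ennreal B"
      using \<tau> by (intro SUP_least Linf_norm_le meas) auto
    then show "(SUP t\<in>{0..\<tau>}. Lp_norm \<infinity> (u t)) < \<infinity>" by (rule le_less_trans) simp
  qed
qed

section \<open>Continuation up to the blow-up time\<close>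

lemma continuous_on_strip_local:
  fixes \<Phi> :: "(real \<Rightarrow> real) \<Rightarrow> real \<Rightarrow> real" and u :: "real \<Rightarrow> real \<Rightarrow> real" and T :: real
  assumes "\<And>t. t \<in> {0..<T} \<Longrightarrow> \<exists>w S c e. 0 < e \<and> continuous_on ({0..<S} \<times> UNIV) (\<lambda>(t, x). \<Phi> (w t) x) \<and>
      (\<forall>s\<in>{0..<T}. \<bar>s - t\<bar> < e \<longrightarrow> s - c \<in> {0..<S} \<and> u s = w (s - c))"
  shows "continuous_on ({0..<T} \<times> UNIV) (\<lambda>(t, x). \<Phi> (u t) x)"
  unfolding continuous_on_eq_continuous_within
proof
  fix p :: "real \<times> real" assume p: "p \<in> {0..<T} \<times> UNIV"
  obtain w S c e where e: "0 < e" and w: "continuous_on ({0..<S} \<times> UNIV) (\<lambda>(t, x). \<Phi> (w t) x)"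
    and eq: "\<And>s. s \<in> {0..<T} \<Longrightarrow> \<bar>s - fst p\<bar> < e \<Longrightarrow> s - c \<in> {0..<S} \<and> u s = w (s - c)"
  proof -
    have "fst p \<in> {0..<T}" using p by (auto simp: mem_Times_iff)
    from assms[OF this] obtain w S c e where "0 < e" "continuous_on ({0..<S} \<times> UNIV) (\<lambda>(t, x). \<Phi> (w t) x)"
      "\<forall>s\<in>{0..<T}. \<bar>s - fst p\<bar> < e \<longrightarrow> s - c \<in> {0..<S} \<and> u s = w (s - c)"
      by (elim exE conjE)
    with that show thesis by blast
  qed
  let ?V = "({0..<T} \<inter> ball (fst p) e) \<times> (UNIV :: real set)"
  have "continuous_on ?V (\<lambda>q. case (fst q - c, snd q) of (t, x) \<Rightarrow> \<Phi> (w t) x)"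
    using eq by (intro continuous_on_compose2[OF w] continuous_intros) (auto simp: dist_real_def abs_minus_commute)
  then have "continuous_on ?V (\<lambda>(t, x). \<Phi> (u t) x)"
    by (rule continuous_on_eq) (use eq in \<open>auto simp: dist_real_def abs_minus_commute\<close>)
  moreover have "p \<in> ?V" using p e by (auto simp: mem_Times_iff)
  ultimately have "continuous (at p within ?V) (\<lambda>(t, x). \<Phi> (u t) x)"
    by (auto simp: continuous_on_eq_continuous_within)
  moreover have "at p within ?V = at p within {0..<T} \<times> UNIV"
    by (rule at_within_nhd[of _ "ball (fst p) e \<times> UNIV"]) (use e in \<open>auto intro: open_Times simp: mem_Times_iff\<close>)
  ultimately show "continuous (at p within {0..<T} \<times> UNIV) (\<lambda>(t, x). \<Phi> (u t) x)" by simp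
qed

text \<open>
  Being a solution is local in time: it suffices that near every time \<open>u\<close> is a time shift of
  some solution. Restarting, gluing and passing to the union of an increasing family are all
  instances. The condition \<open>c < t\<close> excludes that a positive time of \<open>u\<close> corresponds to the initial time of \<open>w\<close>,
  at which \<open>w\<close> need not satisfy the equation.
\<close>

lemma strip_solution_local:
  assumes loc: "\<And>t. t \<in> {0..<T} \<Longrightarrow> \<exists>w S c e. 0 < e \<and> strip_solution f S w \<and> (0 < t \<longrightarrow> c < t) \<and>
      (\<forall>s\<in>{0..<T}. \<bar>s - t\<bar> < e \<longrightarrow> s - c \<in> {0..<S} \<and> u s = w (s - c))"
    and bnd: "\<And>\<tau>. \<tau> \<in> {0..<T} \<Longrightarrow> \<exists>B. \<forall>t\<in>{0..\<tau>}. \<forall>x. \<bar>u t x\<bar> \<le> B"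
  shows "strip_solution f T u"
  unfolding strip_solution_def
proof (intro conjI ballI allI bnd)
  have *: "continuous_on ({0..<T} \<times> UNIV) (\<lambda>(t, x). \<Phi> (u t) x)"
    if \<Phi>: "\<And>S w. strip_solution f S w \<Longrightarrow> continuous_on ({0..<S} \<times> UNIV) (\<lambda>(t, x). \<Phi> (w t) x)"
    for \<Phi> :: "(real \<Rightarrow> real) \<Rightarrow> real \<Rightarrow> real"
  proof (rule continuous_on_strip_local[where \<Phi>=\<Phi> and u=u and T=T])
    fix t assume "t \<in> {0..<T}"
    from loc[OF this] obtain w S c e where "0 < e" "strip_solution f S w"
      "\<forall>s\<in>{0..<T}. \<bar>s - t\<bar> < e \<longrightarrow> s - c \<in> {0..<S} \<and> u s = w (s - c)"
      by (elim exE conjE)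
    then show "\<exists>w S c e. 0 < e \<and> continuous_on ({0..<S} \<times> UNIV) (\<lambda>(t, x). \<Phi> (w t) x) \<and>
      (\<forall>s\<in>{0..<T}. \<bar>s - t\<bar> < e \<longrightarrow> s - c \<in> {0..<S} \<and> u s = w (s - c))"
      using \<Phi> by (intro exI conjI)
  qed
  show "continuous_on ({0..<T} \<times> UNIV) (\<lambda>(t, x). u t x)"
    by (rule *[of "\<lambda>g. g"]) (simp add: strip_solution_def)
  show "continuous_on ({0..<T} \<times> UNIV) (\<lambda>(t, x). deriv (u t) x)"
    by (rule *[of deriv]) (simp add: strip_solution_def)
  show "continuous_on ({0..<T} \<times> UNIV) (\<lambda>(t, x). deriv (deriv (u t)) x)"
    by (rule *[of "\<lambda>g. deriv (deriv g)"]) (simp add: strip_solution_def)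
  show "C2_bounded (u t)" if t: "t \<in> {0..<T}" for t
  proof -
    from loc[OF t] obtain w S c e where "0 < e" "strip_solution f S w"
      "\<forall>s\<in>{0..<T}. \<bar>s - t\<bar> < e \<longrightarrow> s - c \<in> {0..<S} \<and> u s = w (s - c)"
      by (elim exE conjE)
    then have "strip_solution f S w" "t - c \<in> {0..<S}" "u t = w (t - c)" using t by auto
    then show ?thesis by (simp add: strip_solution_def)
  qed
  fix t x assume t: "t \<in> {0<..<T}"
  then have t': "t \<in> {0..<T}" by auto
  obtain w S c e where e: "0 < e" and w: "strip_solution f S w" and c: "c < t"
    and eq: "\<And>s. s \<in> {0..<T} \<Longrightarrow> \<bar>s - t\<bar> < e \<Longrightarrow> s - c \<in> {0..<S} \<and> u s = w (s - c)"
  proof -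
    from loc[OF t'] obtain w S c e where "0 < e" "strip_solution f S w" "0 < t \<longrightarrow> c < t"
      "\<forall>s\<in>{0..<T}. \<bar>s - t\<bar> < e \<longrightarrow> s - c \<in> {0..<S} \<and> u s = w (s - c)"
      by (elim exE conjE)
    with t that show thesis by auto
  qed
  have tc: "t - c \<in> {0<..<S}" "u t = w (t - c)" using eq[OF t'] e c by auto
  have "((\<lambda>s. w s x) has_real_derivative deriv (deriv (u t)) x - 2 * f x * u t x - (u t x)\<^sup>2) (at (t - c))"
    using w tc by (auto simp: strip_solution_def)
  then have d: "((\<lambda>s. w (s - c) x) has_real_derivative deriv (deriv (u t)) x - 2 * f x * u t x - (u t x)\<^sup>2) (at t)"
    using DERIV_shift[of "\<lambda>s. w s x" _ t "- c"] by simp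
  have "eventually (\<lambda>s. s \<in> {0<..<T} \<inter> ball t e) (nhds t)"
    using t e by (intro eventually_nhds_in_open) auto
  then have "\<forall>\<^sub>F s in nhds t. u s x = w (s - c) x"
    by eventually_elim (use eq in \<open>auto simp: dist_real_def abs_minus_commute\<close>)
  then show "((\<lambda>s. u s x) has_real_derivative deriv (deriv (u t)) x - 2 * f x * u t x - (u t x)\<^sup>2) (at t)"
    using d by (subst DERIV_cong_ev[OF refl _ refl]) auto
qed

lemma strip_solution_bounded:
  "strip_solution f T u \<Longrightarrow> \<tau> \<in> {0..<T} \<Longrightarrow> \<exists>B. \<forall>t\<in>{0..\<tau>}. \<forall>x. \<bar>u t x\<bar> \<le> B"
  by (simp add: strip_solution_def)

lemma strip_solution_shift:
  assumes u: "strip_solution f T u" and a: "a \<in> {0..<T}"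
  shows "strip_solution f (T - a) (\<lambda>s. u (a + s))"
proof (rule strip_solution_local)
  show "\<exists>w S c e. 0 < e \<and> strip_solution f S w \<and> (0 < t \<longrightarrow> c < t) \<and>
      (\<forall>s\<in>{0..<T - a}. \<bar>s - t\<bar> < e \<longrightarrow> s - c \<in> {0..<S} \<and> u (a + s) = w (s - c))" if "t \<in> {0..<T - a}" for t
    using u a by (intro exI[of _ u] exI[of _ T] exI[of _ "- a"] exI[of _ 1]) (auto simp: add.commute)
  show "\<exists>B. \<forall>t\<in>{0..\<tau>}. \<forall>x. \<bar>u (a + t) x\<bar> \<le> B" if "\<tau> \<in> {0..<T - a}" for \<tau>
    using strip_solution_bounded[OF u, of "a + \<tau>"] that a by force
qed

text \<open>
  By uniqueness \<open>u\<close> and the restarted solution agree on their common time interval, so the glued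
  function equals \<open>u\<close> in a neighbourhood of the gluing time \<open>a\<close>.
\<close>

lemma strip_solution_extend:
  assumes f: "\<And>x. 0 \<le> f x" and u: "strip_solution f T u" and w: "strip_solution f \<tau> w"
    and a: "a \<in> {0..<T}" and eq: "w 0 = u a" and \<tau>: "0 < \<tau>"
  shows "strip_solution f (a + \<tau>) (\<lambda>t. if t < a then u t else w (t - a))" (is "strip_solution f _ ?v")
proof (rule strip_solution_local)
  have agree: "u (a + s) = w s" if "0 \<le> s" "s < T - a" "s < \<tau>" for s
  proof (rule bounded_solution_unique)
    show "bounded_solution f (min (T - a) \<tau>) (\<lambda>s. u (a + s))" "bounded_solution f (min (T - a) \<tau>) w"
      using strip_solution_shift[OF u a] w by (auto intro: bounded_solution_mono dest!: strip_imp_bounded_solution)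
  qed (use that f eq in auto)
  have vu: "?v s = u s" if "0 \<le> s" "s < T" "s < a + \<tau>" for s
    using agree[of "s - a"] that by auto
  show "\<exists>W S c e. 0 < e \<and> strip_solution f S W \<and> (0 < t \<longrightarrow> c < t) \<and>
      (\<forall>s\<in>{0..<a + \<tau>}. \<bar>s - t\<bar> < e \<longrightarrow> s - c \<in> {0..<S} \<and> ?v s = W (s - c))" if t: "t \<in> {0..<a + \<tau>}" for t
  proof (cases "t \<le> a")
    case True
    have e: "0 < min (T - a) \<tau>" using a \<tau> by auto
    have "s \<in> {0..<T} \<and> ?v s = u s" if "s \<in> {0..<a + \<tau>}" "\<bar>s - t\<bar> < min (T - a) \<tau>" for s
      using vu[of s] that True by auto
    then show ?thesis
      using u e by (intro exI[of _ u] exI[of _ T] exI[of _ 0] exI[of _ "min (T - a) \<tau>"]) auto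
  next
    case False
    then show ?thesis
      using w a by (intro exI[of _ w] exI[of _ \<tau>] exI[of _ a] exI[of _ "t - a"]) auto
  qed
  show "\<exists>B. \<forall>t\<in>{0..s}. \<forall>x. \<bar>?v t x\<bar> \<le> B" if s: "s \<in> {0..<a + \<tau>}" for s
  proof -
    obtain B where B: "\<forall>t\<in>{0..a}. \<forall>x. \<bar>u t x\<bar> \<le> B" using strip_solution_bounded[OF u a] by blast
    obtain C where C: "\<forall>t\<in>{0..max 0 (s - a)}. \<forall>x. \<bar>w t x\<bar> \<le> C"
      using strip_solution_bounded[OF w, of "max 0 (s - a)"] s \<tau> by force
    have "\<bar>?v t x\<bar> \<le> max B C" if "t \<in> {0..s}" for t x
    proof (cases "t < a")
      case True
      then have "\<bar>u t x\<bar> \<le> B" using B that by auto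
      then show ?thesis using True by simp
    next
      case False
      then have "\<bar>w (t - a) x\<bar> \<le> C" using C that by auto
      then show ?thesis using False by simp
    qed
    then show ?thesis by blast
  qed
qed

text \<open>
  The maximal solution is the union of all solutions with datum \<open>h\<close>. The local existence time for data
  bounded by \<open>M\<close> is some \<open>\<tau> > 0\<close>. If the norm were at most \<open>M\<close> at a time later than \<open>T - \<tau>\<close>, the
  solution restarted there would reach beyond \<open>T\<close>. Hence the norm exceeds \<open>M\<close> at all these times,
  which gives a limit rather than only an unbounded sequence.
\<close>

theorem maximal_solution:
  assumes f: "C2_bounded f" "\<And>x. 0 \<le> f x" and h: "C2_bounded h"
    and bound: "\<And>S u. 0 < S \<Longrightarrow> strip_solution f S u \<Longrightarrow> u 0 = h \<Longrightarrow> S \<le> Tmax"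
  obtains T u where "0 < T" "strip_solution f T u" "u 0 = h"
    "((\<lambda>t. Lp_norm \<infinity> (u t)) \<longlongrightarrow> \<infinity>) (at_left T)"
proof -
  define A where "A = {S. 0 < S \<and> (\<exists>u. strip_solution f S u \<and> u 0 = h)}"
  obtain Kh where Kh: "\<And>x. \<bar>h x\<bar> \<le> Kh" using h unfolding C2_bounded_def by blast
  then have "0 \<le> Kh" using abs_ge_zero order_trans by blast
  obtain \<tau>0 where "0 < \<tau>0" "\<exists>u. strip_solution f \<tau>0 u \<and> u 0 = h"
    by (rule local_existence[OF f(1) \<open>0 \<le> Kh\<close>]) (use h Kh in blast)
  then have ne: "\<tau>0 \<in> A" by (simp add: A_def)
  have bdd: "bdd_above A" by (rule bdd_aboveI[of _ Tmax]) (use bound in \<open>auto simp: A_def\<close>)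
  define T where "T = Sup A"
  have T0: "0 < T" using cSup_upper[OF ne bdd] \<open>0 < \<tau>0\<close> by (simp add: T_def)
  have cover: "\<exists>w S. t < S \<and> S \<le> T \<and> strip_solution f S w \<and> w 0 = h" if "t < T" for t
  proof -
    have "\<exists>S\<in>A. t < S" using that ne unfolding T_def by (intro less_cSupD) auto
    then obtain S where "S \<in> A" "t < S" by blast
    moreover have "S \<le> T" using \<open>S \<in> A\<close> bdd unfolding T_def by (rule cSup_upper)
    ultimately show ?thesis by (auto simp: A_def)
  qed
  define U where "U t = (SOME w. \<exists>S. t < S \<and> strip_solution f S w \<and> w 0 = h) t" for t
  have U: "U t = w t" if "strip_solution f S w" "w 0 = h" "t \<in> {0..<S}" for w S t
  proof -
    let ?P = "\<lambda>w. \<exists>S. t < S \<and> strip_solution f S w \<and> w 0 = h"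
    have "?P w" using that by auto
    then have "?P (SOME w. ?P w)" by (rule someI[of ?P])
    then obtain S' where S': "t < S'" "strip_solution f S' (SOME w. ?P w)" "(SOME w. ?P w) 0 = h" by blast
    show ?thesis unfolding U_def
    proof (rule bounded_solution_unique[where u="SOME w. ?P w" and v=w])
      show "bounded_solution f (min S S') (SOME w. ?P w)" "bounded_solution f (min S S') w"
        using S'(2) that(1) by (auto intro: bounded_solution_mono dest!: strip_imp_bounded_solution)
    qed (use S' that f in auto)
  qed
  have strip: "strip_solution f T U"
  proof (rule strip_solution_local)
    show "\<exists>w S c e. 0 < e \<and> strip_solution f S w \<and> (0 < t \<longrightarrow> c < t) \<and>
      (\<forall>s\<in>{0..<T}. \<bar>s - t\<bar> < e \<longrightarrow> s - c \<in> {0..<S} \<and> U s = w (s - c))" if t: "t \<in> {0..<T}" for t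
    proof -
      obtain w S where w: "t < S" "strip_solution f S w" "w 0 = h" using cover[of t] t by auto
      then show ?thesis
        using t U[OF w(2,3)] by (intro exI[of _ w] exI[of _ S] exI[of _ 0] exI[of _ "S - t"]) auto
    qed
    show "\<exists>B. \<forall>t\<in>{0..s}. \<forall>x. \<bar>U t x\<bar> \<le> B" if s: "s \<in> {0..<T}" for s
    proof -
      obtain w S where w: "s < S" "strip_solution f S w" "w 0 = h" using cover[of s] s by auto
      obtain B where "\<forall>t\<in>{0..s}. \<forall>x. \<bar>w t x\<bar> \<le> B" using strip_solution_bounded[OF w(2), of s] w(1) s by auto
      then show ?thesis using U[OF w(2,3)] w(1) by (intro exI[of _ B]) auto
    qed
  qed
  have U0: "U 0 = h"
  proof -
    obtain w S where "0 < S" "strip_solution f S w" "w 0 = h" using cover[OF T0] by auto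
    then show ?thesis using U[of S w 0] by auto
  qed
  have "((\<lambda>t. Lp_norm \<infinity> (U t)) \<longlongrightarrow> top) (at_left T)"
    unfolding tendsto_top_iff_ennreal
  proof (intro allI impI)
    fix M :: real assume M: "0 \<le> M"
    obtain \<tau> where \<tau>: "0 < \<tau>" "\<And>g. C2_bounded g \<Longrightarrow> (\<And>x. \<bar>g x\<bar> \<le> M) \<Longrightarrow> \<exists>u. strip_solution f \<tau> u \<and> u 0 = g"
      by (rule local_existence[OF f(1) M]) blast
    have "eventually (\<lambda>t. t \<in> {max 0 (T - \<tau>)<..<T}) (at_left T)"
      using T0 \<tau>(1) by (intro eventually_at_leftI[of "max 0 (T - \<tau>)"]) auto
    then show "\<forall>\<^sub>F t in at_left T. ennreal M < Lp_norm \<infinity> (U t)"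
    proof eventually_elim
      case (elim t)
      then have t: "t \<in> {0..<T}" "T < t + \<tau>" by auto
      show ?case
      proof (rule ccontr)
        assume "\<not> ennreal M < Lp_norm \<infinity> (U t)"
        then have le: "Lp_norm \<infinity> (U t) \<le> ennreal M" by simp
        have C2: "C2_bounded (U t)" using strip t(1) by (simp add: strip_solution_def)
        have "\<bar>U t x\<bar> \<le> M" for x
          by (rule abs_le_of_Linf_norm_le[where g="U t", OF C2_bounded_continuous[OF C2] le M])
        then obtain w where w: "strip_solution f \<tau> w" "w 0 = U t" using \<tau>(2)[OF C2] by blast
        let ?v = "\<lambda>s. if s < t then U s else w (s - t)"
        have "strip_solution f (t + \<tau>) ?v" by (rule strip_solution_extend[OF f(2) strip w(1) t(1) w(2) \<tau>(1)])
        moreover have "?v 0 = h" using U0 w(2) t(1) by auto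
        ultimately have "t + \<tau> \<in> A" unfolding A_def using t T0 by (auto intro!: exI[of _ ?v])
        then have "t + \<tau> \<le> T" using bdd unfolding T_def by (rule cSup_upper)
        then show False using t by simp
      qed
    qed
  qed
  then show ?thesis using that[OF T0 strip U0] by simp
qed

section \<open>Blow-up of a weighted average\<close>

text \<open>
  First \<open>G \<ge> g\<close> for \<open>g = G 0\<close>: bounding \<open>G^2\<close> from below by its tangent at \<open>g\<close> makes the inequality linear. Then
  \<open>G' / G^2 \<ge> 1 - \<kappa> / g\<close>, so \<open>1 / G\<close> decreases at least at this rate and would be \<open>0\<close> by the
  time \<open>1 / (g - \<kappa>)\<close>.
\<close>

lemma riccati_blow_up:
  fixes G G' :: "real \<Rightarrow> real"
  assumes cont: "continuous_on {0..<T} G"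
    and der: "\<And>t. t \<in> {0<..<T} \<Longrightarrow> (G has_real_derivative G' t) (at t)"
    and ineq: "\<And>t. t \<in> {0<..<T} \<Longrightarrow> (G t)\<^sup>2 - \<kappa> * G t \<le> G' t"
    and \<kappa>: "0 \<le> \<kappa>" "\<kappa> < G 0"
  shows "T \<le> 1 / (G 0 - \<kappa>)"
proof (rule ccontr)
  define g s where "g = G 0" and "s = 1 / (g - \<kappa>)"
  assume "\<not> T \<le> 1 / (G 0 - \<kappa>)"
  then have s: "0 < s" "s < T" using \<kappa> by (auto simp: s_def g_def)
  have g: "0 < g" "\<kappa> < g" using \<kappa> by (auto simp: g_def)
  have contS: "continuous_on {0..t} G" if "t \<le> s" for t
    using cont by (rule continuous_on_subset) (use that s in auto)
  have ge: "g \<le> G t" if t: "t \<in> {0..s}" for t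
  proof -
    \<comment> \<open>The integrating factor for the linearised inequality \<open>(G - g)' \<ge> ?a (G - g)\<close>.\<close>
    let ?a = "2 * g - \<kappa>"
    have "exp (- ?a * 0) * (G 0 - g) \<le> exp (- ?a * t) * (G t - g)"
    proof (rule DERIV_nonneg_imp_increasing_open[where f="\<lambda>t. exp (- ?a * t) * (G t - g)"])
      show "continuous_on {0..t} (\<lambda>t. exp (- ?a * t) * (G t - g))"
        using t by (intro continuous_intros contS) auto
      fix r assume "0 < r" "r < t"
      then have r: "r \<in> {0<..<T}" using t s by auto
      have "((\<lambda>t. exp (- ?a * t) * (G t - g)) has_real_derivative
          exp (- ?a * r) * (G' r - ?a * (G r - g))) (at r)"
        using der[OF r] by (auto intro!: derivative_eq_intros simp: algebra_simps)
      moreover have "0 \<le> G' r - ?a * (G r - g)"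
      proof -
        have "0 \<le> (G r - g)\<^sup>2 + g * (g - \<kappa>)" using g by simp
        also have "\<dots> = (G r)\<^sup>2 - \<kappa> * G r - ?a * (G r - g)" by (simp add: power2_eq_square algebra_simps)
        also have "\<dots> \<le> G' r - ?a * (G r - g)" using ineq[OF r] by simp
        finally show ?thesis .
      qed
      ultimately show "\<exists>y. ((\<lambda>t. exp (- ?a * t) * (G t - g)) has_real_derivative y) (at r) \<and> 0 \<le> y"
        by (intro exI conjI) auto
    qed (use t in auto)
    then have "0 \<le> exp (- ?a * t) * (G t - g)" by (simp add: g_def)
    then show ?thesis by (simp add: zero_le_mult_iff)
  qed
  have pos: "0 < G t" if "t \<in> {0..s}" for t using ge[OF that] g by simp
  define c where "c = 1 - \<kappa> / g"
  have "- (1 / G 0) - c * 0 \<le> - (1 / G s) - c * s"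
  proof (rule DERIV_nonneg_imp_increasing_open[where f="\<lambda>t. - (1 / G t) - c * t"])
    show "continuous_on {0..s} (\<lambda>t. - (1 / G t) - c * t)"
      using pos by (intro continuous_intros contS) force+
    fix r assume "0 < r" "r < s"
    then have r: "r \<in> {0<..<T}" "r \<in> {0..s}" using s by auto
    have "((\<lambda>t. - (1 / G t) - c * t) has_real_derivative G' r / (G r)\<^sup>2 - c) (at r)"
      using der[OF r(1)] pos[OF r(2)]
      by (auto intro!: derivative_eq_intros simp: power2_eq_square)
    moreover have "c \<le> G' r / (G r)\<^sup>2"
    proof -
      have "\<kappa> / G r \<le> \<kappa> / g" using ge[OF r(2)] g \<kappa> by (intro divide_left_mono) auto
      then have "c \<le> 1 - \<kappa> / G r" by (simp add: c_def)
      also have "\<dots> = ((G r)\<^sup>2 - \<kappa> * G r) / (G r)\<^sup>2" using pos[OF r(2)] by (simp add: field_simps power2_eq_square)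
      also have "\<dots> \<le> G' r / (G r)\<^sup>2" using ineq[OF r(1)] by (intro divide_right_mono) auto
      finally show ?thesis .
    qed
    ultimately show "\<exists>y. ((\<lambda>t. - (1 / G t) - c * t) has_real_derivative y) (at r) \<and> 0 \<le> y"
      by (intro exI conjI) auto
  qed (use s in auto)
  moreover have "c * s = 1 / g" using g by (simp add: c_def s_def field_simps)
  moreover have "0 < 1 / G s" using pos[of s] s by simp
  ultimately show False by (simp add: g_def)
qed

text \<open>
  Kaplan's argument is usually run with the first Dirichlet eigenfunction of the interval. This
  polynomial replaces it: the inequality \<open>bump'' \<ge> - (6 / R^2) bump\<close> suffices in place of the eigenvalue equation,
  and as both \<open>bump\<close> and its derivative vanish at the end points, the integration by parts
  leaves no boundary terms.
\<close>

definition bump :: "real \<Rightarrow> real \<Rightarrow> real \<Rightarrow> real" where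
  "bump m R x = (1 - ((x - m) / R)\<^sup>2)\<^sup>2"

definition bump' :: "real \<Rightarrow> real \<Rightarrow> real \<Rightarrow> real" where
  "bump' m R x = - 4 * ((x - m) / R) * (1 - ((x - m) / R)\<^sup>2) / R"

definition bump'' :: "real \<Rightarrow> real \<Rightarrow> real \<Rightarrow> real" where
  "bump'' m R x = (12 * ((x - m) / R)\<^sup>2 - 4) / R\<^sup>2"

lemma bump_derivatives:
  assumes "R \<noteq> 0"
  shows "(bump m R has_real_derivative bump' m R x) (at x)"
    "(bump' m R has_real_derivative bump'' m R x) (at x)"
proof -
  have s: "((\<lambda>x. (x - m) / R) has_real_derivative 1 / R) (at x)"
    using assms by (auto intro!: derivative_eq_intros)
  have "((\<lambda>s. (1 - s\<^sup>2)\<^sup>2) has_real_derivative - 4 * y * (1 - y\<^sup>2)) (at y)" for y :: real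
    by (auto intro!: derivative_eq_intros simp: algebra_simps)
  from DERIV_chain2[OF this s] show "(bump m R has_real_derivative bump' m R x) (at x)"
    by (simp add: bump_def[abs_def] bump'_def)
  have "((\<lambda>s. - 4 * s * (1 - s\<^sup>2) / R) has_real_derivative (12 * y\<^sup>2 - 4) / R) (at y)" for y :: real
    using assms by (auto intro!: derivative_eq_intros simp: field_simps power2_eq_square)
  from DERIV_chain2[OF this s] show "(bump' m R has_real_derivative bump'' m R x) (at x)"
    by (simp add: bump'_def[abs_def] bump''_def power2_eq_square)
qed

lemma bump''_ge:
  assumes "R \<noteq> 0"
  shows "- (6 / R\<^sup>2) * bump m R x \<le> bump'' m R x"
proof -
  define q where "q = ((x - m) / R)\<^sup>2"
  have "0 \<le> (6 * q\<^sup>2 + 2) / R\<^sup>2" by simp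
  also have "\<dots> = bump'' m R x + (6 / R\<^sup>2) * bump m R x"
    unfolding bump_def bump''_def q_def[symmetric] using assms
    by (simp add: field_simps power2_eq_square)
  finally show ?thesis by simp
qed

lemma continuous_on_bump: "continuous_on S (bump m R)" "continuous_on S (bump'' m R)" if "R \<noteq> 0"
  using that unfolding bump_def[abs_def] bump''_def[abs_def] by (auto intro!: continuous_intros)

lemma bump_has_integral:
  assumes R: "0 < R"
  shows "(bump m R has_integral 16 * R / 15) {m - R..m + R}"
proof -
  let ?F = "\<lambda>x. R * (((x - m) / R) - 2 / 3 * ((x - m) / R) ^ 3 + 1 / 5 * ((x - m) / R) ^ 5)"
  have "(?F has_real_derivative bump m R x) (at x)" for x
  proof -
    have s: "((\<lambda>x. (x - m) / R) has_real_derivative 1 / R) (at x)"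
      using R by (auto intro!: derivative_eq_intros)
    have "((\<lambda>s. R * (s - 2 / 3 * s ^ 3 + 1 / 5 * s ^ 5)) has_real_derivative R * (1 - y\<^sup>2)\<^sup>2) (at y)" for y :: real
      by (auto intro!: derivative_eq_intros simp: algebra_simps power2_eq_square power4_eq_xxxx)
    from DERIV_chain2[OF this s] show ?thesis using R by (simp add: bump_def)
  qed
  then have "(bump m R has_integral ?F (m + R) - ?F (m - R)) {m - R..m + R}"
    using R by (intro fundamental_theorem_of_calculus)
      (auto simp flip: has_real_derivative_iff_has_vector_derivative intro: has_field_derivative_at_within)
  moreover have "?F (m + R) - ?F (m - R) = 16 * R / 15"
  proof -
    have e: "(m + R - m) / R = 1" "(m - R - m) / R = - 1" using R by auto
    show ?thesis unfolding e by simp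
  qed
  ultimately show ?thesis by (simp only:)
qed

lemma integral_against_bump:
  fixes w w' w'' :: "real \<Rightarrow> real"
  assumes R: "0 < R"
    and w: "\<And>x. (w has_real_derivative w' x) (at x)" and w': "\<And>x. (w' has_real_derivative w'' x) (at x)"
  shows "((\<lambda>x. w'' x * bump m R x - w x * bump'' m R x) has_integral 0) {m - R..m + R}"
proof -
  let ?F = "\<lambda>x. w' x * bump m R x - w x * bump' m R x"
  have "(?F has_real_derivative w'' x * bump m R x - w x * bump'' m R x) (at x)" for x
    using R bump_derivatives[of R m x] w w'
    by (auto intro!: derivative_eq_intros simp: algebra_simps)
  then have "((\<lambda>x. w'' x * bump m R x - w x * bump'' m R x) has_integral ?F (m + R) - ?F (m - R)) {m - R..m + R}"
    using R by (intro fundamental_theorem_of_calculus)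
      (auto simp flip: has_real_derivative_iff_has_vector_derivative intro: has_field_derivative_at_within)
  moreover have "?F (m + R) - ?F (m - R) = 0" using R by (simp add: bump_def bump'_def)
  ultimately show ?thesis by simp
qed

text \<open>
  For \<open>w = - u\<close>, which is nonnegative by comparison with the zero solution, moving the two derivatives
  to the bump and using \<open>bump''_ge\<close> gives \<open>J G' \<ge> \<integral> (w^2 - \<kappa> w) bump\<close>, where \<open>J\<close> is the integral of the bump and
  \<open>J G\<close> that of \<open>w bump\<close>. Jensen's inequality for the square, in the form \<open>w^2 \<ge> 2 G w - G^2\<close>, turns
  the right-hand side into \<open>J (G^2 - \<kappa> G)\<close>.
\<close>

theorem blow_up_time_bound:
  assumes u: "strip_solution f T u" and T: "0 < T" and f: "\<And>x. 0 \<le> f x" "continuous_on UNIV f"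
    and h: "\<And>x. u 0 x \<le> 0"
    and R: "0 < R" and small: "\<And>x. x \<in> {m - R..m + R} \<Longrightarrow> f x \<le> \<delta>"
    and mass: "6 / R\<^sup>2 + 2 * \<delta> < g" and g: "g = integral {m - R..m + R} (\<lambda>x. - u 0 x * bump m R x) / (16 * R / 15)"
  shows "T \<le> 1 / (g - (6 / R\<^sup>2 + 2 * \<delta>))"
proof -
  let ?I = "{m - R..m + R}"
  define J \<kappa> where "J = 16 * R / 15" and "\<kappa> = 6 / R\<^sup>2 + 2 * \<delta>"
  have J: "0 < J" using R by (simp add: J_def)
  have "0 \<le> \<delta>" using small[of m] f(1)[of m] R by auto
  then have \<kappa>: "0 \<le> \<kappa>" by (simp add: \<kappa>_def)
  have R0: "R \<noteq> 0" using R by simp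
  have cont: "continuous_on ({0..<T} \<times> UNIV) (\<lambda>(t, x). u t x)"
    "continuous_on ({0..<T} \<times> UNIV) (\<lambda>(t, x). deriv (deriv (u t)) x)"
    and C2: "\<And>t. t \<in> {0..<T} \<Longrightarrow> C2_bounded (u t)"
    and pde: "\<And>t x. t \<in> {0<..<T} \<Longrightarrow> ((\<lambda>s. u s x) has_real_derivative
        deriv (deriv (u t)) x - 2 * f x * u t x - (u t x)\<^sup>2) (at t)"
    using u unfolding strip_solution_def by auto
  have np: "u t x \<le> 0" if "t \<in> {0..<T}" for t x
    using bounded_solution_le[OF strip_imp_bounded_solution[OF u] zero_bounded_solution f(1) _ that, of x] h by simp
  note cb = continuous_on_bump[OF R0]
  define G where "G t = integral ?I (\<lambda>x. - u t x * bump m R x) / J" for t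
  let ?ut = "\<lambda>t x. deriv (deriv (u t)) x - 2 * f x * u t x - (u t x)\<^sup>2"
  define G' where "G' t = integral ?I (\<lambda>x. - ?ut t x * bump m R x) / J" for t
  have "T \<le> 1 / (G 0 - \<kappa>)"
  proof (rule riccati_blow_up[where G'=G'])
    have "continuous_on ({0..<T} \<times> cbox (m - R) (m + R)) (\<lambda>(t, x). - u t x * bump m R x)"
      using continuous_on_subset[OF cont(1), of "{0..<T} \<times> cbox (m - R) (m + R)"]
      unfolding case_prod_beta by (intro continuous_intros continuous_on_compose2[OF cb(1)]) auto
    then have "continuous_on {0..<T} (\<lambda>t. integral ?I (\<lambda>x. - u t x * bump m R x))"
      unfolding interval_cbox by (rule integral_continuous_on_param)
    then show "continuous_on {0..<T} G"
      unfolding G_def using J by (intro continuous_on_divide continuous_on_const) auto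
    fix t assume t: "t \<in> {0<..<T}"
    have c: "continuous_on ?I (u t)" "continuous_on ?I (deriv (deriv (u t)))"
      using t continuous_on_slice[OF cont(1), of t] continuous_on_slice[OF cont(2), of t]
      by (auto intro: continuous_on_subset)
    have sub: "{0<..<T} \<times> cbox (m - R) (m + R) \<subseteq> {0..<T} \<times> UNIV" by auto
    have "((\<lambda>t. integral (cbox (m - R) (m + R)) (\<lambda>x. - u t x * bump m R x)) has_real_derivative
        integral (cbox (m - R) (m + R)) (\<lambda>x. - ?ut t x * bump m R x)) (at t within {0<..<T})"
    proof (rule leibniz_rule_field_derivative)
      show "((\<lambda>t. - u t x * bump m R x) has_real_derivative - ?ut s x * bump m R x) (at s within {0<..<T})"
        if "s \<in> {0<..<T}" for s x
        by (rule has_field_derivative_at_within[OF DERIV_cmult_right[OF DERIV_minus[OF pde[OF that]]]])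
      show "(\<lambda>x. - u s x * bump m R x) integrable_on cbox (m - R) (m + R)" if "s \<in> {0<..<T}" for s
      proof -
        have "continuous_on (cbox (m - R) (m + R)) (u s)"
          using that by (intro continuous_on_subset[OF continuous_on_slice[OF cont(1)]]) auto
        then show ?thesis by (intro integrable_continuous continuous_intros cb)
      qed
      show "continuous_on ({0<..<T} \<times> cbox (m - R) (m + R)) (\<lambda>(t, x). - ?ut t x * bump m R x)"
        using continuous_on_subset[OF cont(1) sub] continuous_on_subset[OF cont(2) sub]
        unfolding case_prod_beta
        by (intro continuous_intros continuous_on_compose2[OF cb(1)] continuous_on_compose2[OF f(2)]) auto
    qed (use t in auto)
    then show "(G has_real_derivative G' t) (at t)"
      unfolding G_def[abs_def] G'_def using t J
      by (intro DERIV_cdivide) (simp add: at_within_open[of t "{0<..<T}"])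
    have cancel: "J * (X / J) = X" for X using J by simp
    have iu: "((\<lambda>x. - u t x * bump m R x) has_integral J * G t) ?I"
    proof -
      have i: "(\<lambda>x. - u t x * bump m R x) integrable_on ?I"
        by (intro integrable_continuous_interval continuous_intros c cb)
      have e: "J * G t = integral ?I (\<lambda>x. - u t x * bump m R x)" unfolding G_def by (rule cancel)
      show ?thesis unfolding e by (rule integrable_integral[OF i])
    qed
    have iut: "((\<lambda>x. - ?ut t x * bump m R x) has_integral J * G' t) ?I"
    proof -
      have i: "(\<lambda>x. - ?ut t x * bump m R x) integrable_on ?I"
        by (intro integrable_continuous_interval continuous_intros c cb continuous_on_subset[OF f(2)]) auto
      have e: "J * G' t = integral ?I (\<lambda>x. - ?ut t x * bump m R x)" unfolding G'_def by (rule cancel)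
      show ?thesis unfolding e by (rule integrable_integral[OF i])
    qed
    have ib: "(bump m R has_integral J) ?I"
      using bump_has_integral[OF R] by (simp add: J_def)
    have parts: "((\<lambda>x. deriv (deriv (u t)) x * bump m R x - u t x * bump'' m R x) has_integral 0) ?I"
      using C2[of t] t by (intro integral_against_bump[OF R, of "u t" "deriv (u t)"]) (auto simp: C2_bounded_def)
    have "(2 * G t - \<kappa>) * (J * G t) - (G t)\<^sup>2 * J \<le> J * G' t + 0"
    proof (rule has_integral_le)
      show "((\<lambda>x. (2 * G t - \<kappa>) * (- u t x * bump m R x) - (G t)\<^sup>2 * bump m R x) has_integral
          (2 * G t - \<kappa>) * (J * G t) - (G t)\<^sup>2 * J) ?I"
        by (intro has_integral_diff has_integral_mult_right iu ib)
      show "((\<lambda>x. - ?ut t x * bump m R x + (deriv (deriv (u t)) x * bump m R x - u t x * bump'' m R x)) has_integral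
          J * G' t + 0) ?I"
        by (intro has_integral_add iut parts)
      fix x assume x: "x \<in> ?I"
      define v b where "v = - u t x" and "b = bump m R x"
      have v: "0 \<le> v" and b: "0 \<le> b" using np[of t x] t by (auto simp: v_def b_def bump_def)
      have "v * (- (6 / R\<^sup>2) * b) \<le> v * bump'' m R x"
        unfolding b_def using v by (intro mult_left_mono bump''_ge R0)
      moreover have "f x * (v * b) \<le> \<delta> * (v * b)" using small[OF x] v b by (intro mult_right_mono) auto
      moreover have "0 \<le> (v - G t)\<^sup>2 * b" using b by simp
      ultimately have "(2 * G t - \<kappa>) * (v * b) - (G t)\<^sup>2 * b \<le> - 2 * (f x * (v * b)) + v\<^sup>2 * b + v * bump'' m R x"
        by (simp add: \<kappa>_def power2_eq_square algebra_simps)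
      then show "(2 * G t - \<kappa>) * (- u t x * bump m R x) - (G t)\<^sup>2 * bump m R x
          \<le> - ?ut t x * bump m R x + (deriv (deriv (u t)) x * bump m R x - u t x * bump'' m R x)"
        by (simp add: v_def b_def algebra_simps)
    qed
    then have "J * ((G t)\<^sup>2 - \<kappa> * G t) \<le> J * G' t" by (simp add: algebra_simps power2_eq_square)
    then show "(G t)\<^sup>2 - \<kappa> * G t \<le> G' t" using J by simp
  qed (use mass \<kappa> in \<open>auto simp: G_def g J_def \<kappa>_def\<close>)
  then show ?thesis by (simp add: G_def g J_def \<kappa>_def)
qed

section \<open>The initial datum\<close>

lemma smooth_imp_C2_bounded:
  assumes s: "smooth f" and lim: "(f \<longlongrightarrow> 0) at_infinity"
    and b: "bounded (range (deriv f))" "bounded (range (deriv (deriv f)))"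
  shows "C2_bounded f"
proof -
  have d: "(deriv ^^ n) f field_differentiable at x" for n x using s by (simp add: smooth_def)
  have d0: "f field_differentiable at x" "deriv f field_differentiable at x"
    "deriv (deriv f) field_differentiable at x" for x
    using d[of 0 x] d[of 1 x] d[of 2 x] by (simp_all add: numeral_2_eq_2)
  have c: "continuous_on UNIV f" "continuous_on UNIV (deriv (deriv f))"
    using d0(1,3) by (auto intro!: continuous_at_imp_continuous_on field_differentiable_imp_continuous_at)
  have "eventually (\<lambda>x. dist (f x) 0 < 1) at_infinity" using lim by (rule tendstoD) simp
  then obtain N where N: "\<And>x. N \<le> \<bar>x\<bar> \<Longrightarrow> \<bar>f x\<bar> < 1" by (auto simp: eventually_at_infinity)
  have "bounded (f ` {-\<bar>N\<bar>..\<bar>N\<bar>})"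
    by (intro compact_imp_bounded compact_continuous_image continuous_on_subset[OF c(1)]) auto
  then obtain K where K: "\<And>x. x \<in> {-\<bar>N\<bar>..\<bar>N\<bar>} \<Longrightarrow> \<bar>f x\<bar> \<le> K" unfolding bounded_iff by fastforce
  have f: "\<bar>f x\<bar> \<le> max K 1" for x
    using N[of x] K[of x] by (cases "N \<le> \<bar>x\<bar>") (auto simp: abs_le_iff le_max_iff_disj less_imp_le)
  obtain K1 where K1: "\<And>x. \<bar>deriv f x\<bar> \<le> K1" using b(1) by (auto simp: bounded_iff)
  obtain K2 where K2: "\<And>x. \<bar>deriv (deriv f) x\<bar> \<le> K2" using b(2) by (auto simp: bounded_iff)
  show ?thesis
    unfolding C2_bounded_def
  proof (intro conjI allI)
    show "\<exists>B. \<forall>x. \<bar>f x\<bar> \<le> B \<and> \<bar>deriv f x\<bar> \<le> B \<and> \<bar>deriv (deriv f) x\<bar> \<le> B"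
      using f K1 K2 by (intro exI[of _ "max (max K 1) (max K1 K2)"]) (simp add: le_max_iff_disj)
  qed (use c d0 in \<open>auto simp: field_differentiable_derivI\<close>)
qed

definition gaussian_dip :: "real \<Rightarrow> real \<Rightarrow> real \<Rightarrow> real" where
  "gaussian_dip A m x = - A * exp (- (x - m)\<^sup>2)"

lemma poly_gaussian_has_derivative:
  "((\<lambda>x. poly p x * exp (- (x - m)\<^sup>2)) has_real_derivative
    poly (pderiv p - 2 * [:- m, 1:] * p) x * exp (- (x - m)\<^sup>2)) (at x)"
  by (auto intro!: derivative_eq_intros simp: algebra_simps)

lemma smooth_gaussian_dip: "smooth (gaussian_dip A m)"
proof -
  have *: "\<exists>p. (deriv ^^ n) (gaussian_dip A m) = (\<lambda>x. poly p x * exp (- (x - m)\<^sup>2))" for n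
  proof (induction n)
    case 0
    show ?case by (rule exI[of _ "[:- A:]"]) (simp add: gaussian_dip_def[abs_def])
  next
    case (Suc n)
    then obtain p where p: "(deriv ^^ n) (gaussian_dip A m) = (\<lambda>x. poly p x * exp (- (x - m)\<^sup>2))" by blast
    have "(deriv ^^ Suc n) (gaussian_dip A m) = (\<lambda>x. poly (pderiv p - 2 * [:- m, 1:] * p) x * exp (- (x - m)\<^sup>2))"
      unfolding funpow.simps comp_def p by (intro ext DERIV_imp_deriv poly_gaussian_has_derivative)
    then show ?case by blast
  qed
  show ?thesis
    unfolding smooth_def
  proof (intro allI)
    fix n x
    obtain p where "(deriv ^^ n) (gaussian_dip A m) = (\<lambda>x. poly p x * exp (- (x - m)\<^sup>2))" using * by blast
    then show "(deriv ^^ n) (gaussian_dip A m) field_differentiable at x"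
      using poly_gaussian_has_derivative[of p m x] unfolding field_differentiable_def by auto
  qed
qed

lemma C2_bounded_gaussian_dip:
  assumes A: "0 \<le> A"
  shows "C2_bounded (gaussian_dip A m)"
proof -
  let ?g = "\<lambda>x. exp (- (x - m)\<^sup>2)"
  have d1: "(gaussian_dip A m has_real_derivative 2 * A * (x - m) * ?g x) (at x)" for x
    unfolding gaussian_dip_def[abs_def] by (auto intro!: derivative_eq_intros simp: algebra_simps)
  then have e1: "deriv (gaussian_dip A m) = (\<lambda>x. 2 * A * (x - m) * ?g x)" by (intro ext DERIV_imp_deriv)
  have d2: "((\<lambda>x. 2 * A * (x - m) * ?g x) has_real_derivative 2 * A * (1 - 2 * (x - m)\<^sup>2) * ?g x) (at x)" for x
    by (auto intro!: derivative_eq_intros simp: algebra_simps power2_eq_square)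
  then have e2: "deriv (\<lambda>x. 2 * A * (x - m) * ?g x) = (\<lambda>x. 2 * A * (1 - 2 * (x - m)\<^sup>2) * ?g x)"
    by (intro ext DERIV_imp_deriv)
  have le: "c * ?g x \<le> 1" if "c \<le> 1 + (x - m)\<^sup>2" for c x
  proof -
    have "c \<le> exp ((x - m)\<^sup>2)" using that exp_ge_add_one_self[of "(x - m)\<^sup>2"] by linarith
    then have "c * ?g x \<le> exp ((x - m)\<^sup>2) * ?g x" by (intro mult_right_mono) auto
    then show ?thesis by (simp flip: exp_add)
  qed
  have b1: "\<bar>x - m\<bar> * ?g x \<le> 1" for x
  proof (rule le)
    have "y \<le> 1 + y\<^sup>2" if "0 \<le> y" for y :: real
      using that zero_le_power2[of "y - 1"] by (simp add: power2_diff)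
    from this[of "\<bar>x - m\<bar>"] show "\<bar>x - m\<bar> \<le> 1 + (x - m)\<^sup>2" by simp
  qed
  have b2: "(x - m)\<^sup>2 * ?g x \<le> 1" for x by (rule le) simp
  have b0: "?g x \<le> 1" for x by simp
  show ?thesis
    unfolding C2_bounded_def e1 e2
  proof (intro conjI allI d1 d2)
    show "continuous_on UNIV (\<lambda>x. 2 * A * (1 - 2 * (x - m)\<^sup>2) * ?g x)" by (intro continuous_intros)
    have "\<bar>gaussian_dip A m x\<bar> \<le> 6 * A \<and> \<bar>2 * A * (x - m) * ?g x\<bar> \<le> 6 * A \<and>
        \<bar>2 * A * (1 - 2 * (x - m)\<^sup>2) * ?g x\<bar> \<le> 6 * A" for x
    proof (intro conjI)
      have "A * ?g x \<le> A * 1" using A by (intro mult_left_mono) auto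
      then show "\<bar>gaussian_dip A m x\<bar> \<le> 6 * A" using A by (simp add: gaussian_dip_def abs_mult)
      have "2 * A * (\<bar>x - m\<bar> * ?g x) \<le> 2 * A * 1" using A b1[of x] by (intro mult_left_mono) auto
      then show "\<bar>2 * A * (x - m) * ?g x\<bar> \<le> 6 * A" using A by (simp add: abs_mult mult.assoc)
      have "\<bar>(1 - 2 * s) * e\<bar> \<le> 3" if "0 \<le> s" "0 \<le> e" "e \<le> 1" "s * e \<le> 1" for s e :: real
        using that mult_nonneg_nonneg[OF that(1,2)]
        unfolding left_diff_distrib mult.assoc abs_le_iff mult_1_left by linarith
      then have "\<bar>(1 - 2 * (x - m)\<^sup>2) * ?g x\<bar> \<le> 3" using b0[of x] b2[of x] by simp
      then have "2 * A * \<bar>(1 - 2 * (x - m)\<^sup>2) * ?g x\<bar> \<le> 2 * A * 3" using A by (intro mult_left_mono) auto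
      then show "\<bar>2 * A * (1 - 2 * (x - m)\<^sup>2) * ?g x\<bar> \<le> 6 * A" using A by (simp add: abs_mult mult.assoc)
    qed
    then show "\<exists>B. \<forall>x. \<bar>gaussian_dip A m x\<bar> \<le> B \<and> \<bar>2 * A * (x - m) * ?g x\<bar> \<le> B \<and>
        \<bar>2 * A * (1 - 2 * (x - m)\<^sup>2) * ?g x\<bar> \<le> B" by blast
  qed
qed

lemma nn_integral_gaussian: "(\<integral>\<^sup>+x. ennreal (exp (- (x - m)\<^sup>2)) \<partial>lborel) = ennreal (sqrt pi)"
proof -
  have eq: "exp (- (x - m)\<^sup>2) = sqrt pi * normal_density m (1 / sqrt 2) x" for x
    by (simp add: normal_density_def power_divide)
  have "(\<integral>\<^sup>+x. ennreal (exp (- (x - m)\<^sup>2)) \<partial>lborel) = ennreal (\<integral>x. exp (- (x - m)\<^sup>2) \<partial>lborel)"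
    unfolding eq by (intro nn_integral_eq_integral integrable_mult_right integrable_normal_density) auto
  also have "(\<integral>x. exp (- (x - m)\<^sup>2) \<partial>lborel) = sqrt pi"
    unfolding eq by simp
  finally show ?thesis .
qed

text \<open>
  As \<open>p \<ge> 1\<close>, the \<open>p\<close>-th power of the Gaussian lies below the Gaussian itself up to the factor of the height, so
  for finite \<open>p\<close> the norm is at most \<open>A \<pi>^(1 / (2 p)) \<le> 2 A\<close>, uniformly in \<open>p\<close>.
\<close>

lemma Lp_norm_gaussian_dip_less:
  assumes A: "0 < A" and p: "1 \<le> p"
  shows "Lp_norm p (gaussian_dip A m) < ennreal (3 * A)"
proof -
  have abs: "\<bar>gaussian_dip A m x\<bar> = A * exp (- (x - m)\<^sup>2)" for x using A by (simp add: gaussian_dip_def abs_mult)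
  have meas: "gaussian_dip A m \<in> borel_measurable borel" unfolding gaussian_dip_def[abs_def] by measurable
  show ?thesis
  proof (cases "p = \<infinity>")
    case True
    have "Lp_norm \<infinity> (gaussian_dip A m) \<le> ennreal A"
      using meas A by (intro Linf_norm_le) (auto simp: abs)
    also have "\<dots> < ennreal (3 * A)" using A by (intro ennreal_lessI) auto
    finally show ?thesis using True by simp
  next
    case False
    define q where "q = enn2real p"
    have q: "1 \<le> q" unfolding q_def using p False by (metis enn2real_mono enn2real_1 infinity_ennreal_def top.not_eq_extremum)
    define I where "I = (\<integral>\<^sup>+x. ennreal (\<bar>gaussian_dip A m x\<bar> powr q) \<partial>lborel)"
    have "I \<le> (\<integral>\<^sup>+x. ennreal (A powr q) * ennreal (exp (- (x - m)\<^sup>2)) \<partial>lborel)"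
      unfolding I_def
    proof (intro nn_integral_mono)
      fix x
      have "exp (- (x - m)\<^sup>2) powr q = exp (- (q * (x - m)\<^sup>2))" by (simp add: powr_def)
      also have "\<dots> \<le> exp (- (x - m)\<^sup>2)" using q mult_right_mono[of 1 q "(x - m)\<^sup>2"] by simp
      finally have "\<bar>gaussian_dip A m x\<bar> powr q \<le> A powr q * exp (- (x - m)\<^sup>2)"
        unfolding abs using A by (simp add: powr_mult mult_left_mono)
      then show "ennreal (\<bar>gaussian_dip A m x\<bar> powr q) \<le> ennreal (A powr q) * ennreal (exp (- (x - m)\<^sup>2))"
        by (simp add: ennreal_leI flip: ennreal_mult')
    qed
    also have "\<dots> = ennreal (A powr q * sqrt pi)"
      by (subst nn_integral_cmult) (auto simp: nn_integral_gaussian simp flip: ennreal_mult')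
    finally have I: "I \<le> ennreal (A powr q * sqrt pi)" .
    then have fin: "I \<noteq> \<infinity>" by (auto simp: top_unique)
    have "enn2real I \<le> A powr q * sqrt pi" using I A by (intro enn2real_leI) auto
    also have "\<dots> \<le> A powr q * 2 powr q"
    proof (intro mult_left_mono)
      have "sqrt pi \<le> sqrt 4" using pi_less_4 by (intro real_sqrt_le_mono) simp
      also have "\<dots> \<le> 2 powr q" using q powr_mono[of 1 q 2] by simp
      finally show "sqrt pi \<le> 2 powr q" .
    qed simp
    also have "\<dots> = (2 * A) powr q" using A by (simp add: powr_mult)
    finally have "enn2real I powr (1 / q) \<le> ((2 * A) powr q) powr (1 / q)"
      using q by (intro powr_mono2) auto
    also have "\<dots> = 2 * A" using q A by (simp add: powr_powr)
    also have "\<dots> < 3 * A" using A by simp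
    finally have "ennreal (enn2real I powr (1 / q)) < ennreal (3 * A)" using A by (intro ennreal_lessI) auto
    then show ?thesis using False fin by (simp add: Lp_norm_def I_def q_def Let_def)
  qed
qed

text \<open>
  Already the part of the Gaussian within distance \<open>1\<close> of the centre has a mass of order \<open>A\<close>, whereas the
  bump has total mass \<open>16 R / 15\<close>. There the Gaussian is at least \<open>A / 3\<close> and the bump at least \<open>(3 / 4)^2\<close>.
\<close>

lemma gaussian_dip_mass:
  assumes A: "0 < A" and R: "2 \<le> R"
  shows "A / (4 * R) < integral {m - R..m + R} (\<lambda>x. - gaussian_dip A m x * bump m R x) / (16 * R / 15)"
proof -
  let ?k = "\<lambda>x. - gaussian_dip A m x * bump m R x"
  have c: "continuous_on S ?k" for S
    unfolding gaussian_dip_def bump_def using R by (intro continuous_intros) auto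
  have "3 * A / 16 * 2 = integral {m - 1..m + 1} (\<lambda>x. 3 * A / 16)" by simp
  also have "\<dots> \<le> integral {m - 1..m + 1} ?k"
  proof (intro integral_le integrable_continuous_interval c)
    fix x assume x: "x \<in> {m - 1..m + 1}"
    then have "\<bar>x - m\<bar> \<le> 1" by auto
    then have q: "(x - m)\<^sup>2 \<le> 1" by (simp add: abs_square_le_1)
    have "1 / 3 \<le> exp (- 1 :: real)" using exp_le by (simp add: exp_minus field_simps)
    also have "\<dots> \<le> exp (- (x - m)\<^sup>2)" using q by simp
    finally have e: "A * (1 / 3) \<le> A * exp (- (x - m)\<^sup>2)" using A by (intro mult_left_mono) auto
    have "((x - m) / R)\<^sup>2 \<le> 1 / 4"
    proof -
      have "(2::real)\<^sup>2 \<le> R\<^sup>2" using R by (intro power_mono) auto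
      then have "(x - m)\<^sup>2 / R\<^sup>2 \<le> 1 / 4" using q R by (simp add: divide_le_eq)
      then show ?thesis by (simp add: power_divide)
    qed
    then have "(3 / 4)\<^sup>2 \<le> bump m R x" unfolding bump_def by (intro power_mono) auto
    then have "A * (1 / 3) * (3 / 4)\<^sup>2 \<le> A * exp (- (x - m)\<^sup>2) * bump m R x"
      using e A by (intro mult_mono) auto
    then show "3 * A / 16 \<le> ?k x" by (simp add: gaussian_dip_def power2_eq_square)
  qed (auto intro: continuous_intros)
  also have "\<dots> \<le> integral {m - R..m + R} ?k"
    using A R by (intro integral_subset_le integrable_continuous_interval c)
      (auto simp: gaussian_dip_def bump_def)
  finally have "3 * A / 8 / (16 * R / 15) \<le> integral {m - R..m + R} ?k / (16 * R / 15)"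
    using R by (intro divide_right_mono) auto
  moreover have "A / (4 * R) < 3 * A / 8 / (16 * R / 15)" using A R by (simp add: field_simps)
  ultimately show ?thesis by linarith
qed

theorem theorem5:
  fixes f :: "real \<Rightarrow> real"
  assumes "smooth f"
    and "\<And>x. f x > 0"
    and "(f \<longlongrightarrow> 0) at_infinity"
    and "bounded (range (deriv f))"
    and "bounded (range (deriv (deriv f)))"
  shows "\<exists>\<epsilon>\<^sub>0::real. \<epsilon>\<^sub>0 > 0 \<and> (\<forall>\<epsilon>::real. 0 < \<epsilon> \<and> \<epsilon> < \<epsilon>\<^sub>0 \<longrightarrow>
    (\<exists>h :: real \<Rightarrow> real.
       smooth h \<and>
       (\<forall>p. 1 \<le> p \<longrightarrow> Lp_norm p h < ennreal \<epsilon>) \<and>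
       (\<exists>T::real. T > 0 \<and> (\<exists>u :: real \<Rightarrow> real \<Rightarrow> real.
          classical_solution f h T u \<and> locally_bounded_in_time T u \<and>
          (\<forall>v. classical_solution f h T v \<and> locally_bounded_in_time T v \<longrightarrow>
             (\<forall>t\<in>{0..<T}. v t = u t)) \<and>
          ((\<lambda>t. Lp_norm \<infinity> (u t)) \<longlongrightarrow> \<infinity>) (at_left T)))))"
proof (intro exI[of _ 1] conjI allI impI)
  fix \<epsilon> :: real assume \<epsilon>: "0 < \<epsilon> \<and> \<epsilon> < 1"
  have C2: "C2_bounded f" using assms(1,3,4,5) by (rule smooth_imp_C2_bounded)
  have f0: "0 \<le> f x" for x using assms(2)[of x] by simp
  have fc: "continuous_on UNIV f" using C2 by (rule C2_bounded_continuous)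
  \<comment> \<open>With \<open>R = 48 / A\<close> the diffusive loss \<open>6 / R^2\<close> equals \<open>A / (8 R)\<close>; the potential may cost half of that, and the two together stay below the initial average, which exceeds \<open>A / (4 R)\<close>.\<close>
  define A R \<delta> where "A = \<epsilon> / 3" and "R = 48 / A" and "\<delta> = A / (32 * R)"
  have A: "0 < A" "A < 1" using \<epsilon> by (auto simp: A_def)
  have R: "48 \<le> R" using A by (simp add: R_def field_simps)
  have \<delta>: "0 < \<delta>" using A R by (simp add: \<delta>_def)
  have "eventually (\<lambda>x. dist (f x) 0 < \<delta>) at_infinity" using assms(3) \<delta> by (rule tendstoD)
  then obtain N where N: "\<And>x. N \<le> \<bar>x\<bar> \<Longrightarrow> \<bar>f x\<bar> < \<delta>" by (auto simp: eventually_at_infinity)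
  define m where "m = \<bar>N\<bar> + R"
  define h where "h = gaussian_dip A m"
  have small: "f x \<le> \<delta>" if "x \<in> {m - R..m + R}" for x
    using N[of x] that by (simp add: m_def abs_le_iff abs_less_iff)
  define g where "g = integral {m - R..m + R} (\<lambda>x. - h x * bump m R x) / (16 * R / 15)"
  have mass: "6 / R\<^sup>2 + 2 * \<delta> < g"
  proof -
    have "6 / R\<^sup>2 = A / (8 * R)" using A by (simp add: R_def power2_eq_square field_simps)
    then have "6 / R\<^sup>2 + 2 * \<delta> < A / (4 * R)" using A R by (simp add: \<delta>_def field_simps)
    also have "\<dots> < g" unfolding g_def h_def using A R by (intro gaussian_dip_mass) auto
    finally show ?thesis .
  qed
  have hC2: "C2_bounded h" unfolding h_def using A by (intro C2_bounded_gaussian_dip) auto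
  obtain T u where u: "0 < T" "strip_solution f T u" "u 0 = h"
    "((\<lambda>t. Lp_norm \<infinity> (u t)) \<longlongrightarrow> \<infinity>) (at_left T)"
  proof (rule maximal_solution[OF C2 f0 hC2])
    show "S \<le> 1 / (g - (6 / R\<^sup>2 + 2 * \<delta>))" if "0 < S" "strip_solution f S v" "v 0 = h" for S v
      using that(2,1) f0 fc
    proof (rule blow_up_time_bound)
      show "v 0 x \<le> 0" for x using that(3) A by (simp add: h_def gaussian_dip_def)
    qed (use R small mass that(3) in \<open>auto simp: g_def\<close>)
  qed
  have cl: "classical_solution f h T u" "locally_bounded_in_time T u"
    using strip_imp_classical_solution[OF u(2) fc] by (simp_all add: u(3))
  show "\<exists>h. smooth h \<and> (\<forall>p. 1 \<le> p \<longrightarrow> Lp_norm p h < ennreal \<epsilon>) \<and>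
      (\<exists>T::real. T > 0 \<and> (\<exists>u.
          classical_solution f h T u \<and> locally_bounded_in_time T u \<and>
          (\<forall>v. classical_solution f h T v \<and> locally_bounded_in_time T v \<longrightarrow>
             (\<forall>t\<in>{0..<T}. v t = u t)) \<and>
          ((\<lambda>t. Lp_norm \<infinity> (u t)) \<longlongrightarrow> \<infinity>) (at_left T)))"
  proof (intro exI[of _ h] conjI exI[of _ T] exI[of _ u] allI impI ballI)
    show "smooth h" unfolding h_def by (rule smooth_gaussian_dip)
    show "Lp_norm p h < ennreal \<epsilon>" if "1 \<le> p" for p
      using Lp_norm_gaussian_dip_less[OF A(1) that] by (simp add: h_def A_def)
    fix v t assume v: "classical_solution f h T v \<and> locally_bounded_in_time T v" and t: "t \<in> {0..<T}"
    have "bounded_solution f T v" using v by (blast intro: classical_imp_bounded_solution)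
    moreover have "v 0 = u 0" using v by (auto simp: classical_solution_def u(3))
    ultimately show "v t = u t"
      using bounded_solution_unique[of f T v u t] strip_imp_bounded_solution[OF u(2)] f0 t by blast
  qed (fact u(1) cl u(4))+
qed simp

end
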